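(* Let $r\ge2$ be a fixed integer, $a>b>0$ fixed, and $n=rK$. In the stochastic block model with $r$ clusters of equal size $K$, let $\widehat Z_{\mathrm{SDP}}$ be the solution of $$\max_Z\ \langle A,Z\rangle\quad\text{s.t.}\quad Z\succeq0,\ \ Z_{ii}=1\ (i\in[n]),\ \ Z_{ij}\ge0\ (i,j\in[n]),\ \ Z\mathbf 1=K\mathbf 1.$$ If $\sqrt a-\sqrt b>\sqrt r$, then $\min_{Z^*\in\mathcal Z_{n,r}}\mathbb P\{\widehat Z_{\mathrm{SDP}}=Z^*\}\ge1-n^{-\Omega(1)}$ as $n\to\infty$ (where $\widehat Z_{\mathrm{SDP}}=Z^*$ means $Z^*$ is the unique optimal solution).
   Context: SBM with $r$ equal-sized clusters: the vertex set $[n]$ is partitioned into clusters $C_1,\dots,C_r$ each of size $K$, with indicator vectors $\xi^*_k\in\{0,1\}^n$. Each pair $\{i,j\}$ is independently connected with probability $p=a\log n/n$ if $i,j$ are in the same cluster and $q=b\log n/n$ otherwise; $A$ is the adjacency matrix. $Z^*=\sum_{k=1}^r\xi^*_k(\xi^*_k)^\top$, and $\mathcal Z_{n,r}=\{\sum_{k=1}^r\xi_k\xi_k^\top:\xi_k\in\{0,1\}^n,\ \xi_k^\top\mathbf 1=K,\ \xi_k^\top\xi_{k'}=0\ (k\ne k')\}$. *)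

theory Defs
  imports "HOL-Probability.Probability"
begin

text \<open>Vertices are 0..<n. Matrices are functions nat => nat => real, only entries with
indices < n matter.\<close>

definition vpairs :: "nat \<Rightarrow> (nat \<times> nat) set" where
  "vpairs n = {(i, j). i < j \<and> j < n}"

definition balanced_labelling :: "nat \<Rightarrow> nat \<Rightarrow> (nat \<Rightarrow> nat) \<Rightarrow> bool" where
  "balanced_labelling r K \<sigma> \<longleftrightarrow>
     (\<forall>i < r * K. \<sigma> i < r) \<and> (\<forall>k < r. card {i. i < r * K \<and> \<sigma> i = k} = K)"

text \<open>Z* = sum_k xi_k xi_k^T: entry 1 iff i, j are in the same cluster.\<close>
definition cluster_matrix :: "(nat \<Rightarrow> nat) \<Rightarrow> nat \<Rightarrow> nat \<Rightarrow> real" where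
  "cluster_matrix \<sigma> i j = (if \<sigma> i = \<sigma> j then 1 else 0)"

definition sbm :: "nat \<Rightarrow> real \<Rightarrow> real \<Rightarrow> (nat \<Rightarrow> nat) \<Rightarrow> (nat \<times> nat \<Rightarrow> bool) pmf" where
  "sbm n a b \<sigma> = Pi_pmf (vpairs n) False
     (\<lambda>(i, j). bernoulli_pmf (if \<sigma> i = \<sigma> j then a * ln n / n else b * ln n / n))"

text \<open>Adjacency matrix of a graph given by its edge indicator on pairs i<j.\<close>
definition adj_matrix :: "(nat \<times> nat \<Rightarrow> bool) \<Rightarrow> nat \<Rightarrow> nat \<Rightarrow> real" where
  "adj_matrix G i j = (if G (i, j) \<or> G (j, i) then 1 else 0)"

definition mat_inner :: "nat \<Rightarrow> (nat \<Rightarrow> nat \<Rightarrow> real) \<Rightarrow> (nat \<Rightarrow> nat \<Rightarrow> real) \<Rightarrow> real" where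
  "mat_inner n A Z = (\<Sum>i<n. \<Sum>j<n. A i j * Z i j)"

definition psd :: "nat \<Rightarrow> (nat \<Rightarrow> nat \<Rightarrow> real) \<Rightarrow> bool" where
  "psd n Z \<longleftrightarrow> (\<forall>i<n. \<forall>j<n. Z i j = Z j i) \<and>
     (\<forall>x :: nat \<Rightarrow> real. 0 \<le> (\<Sum>i<n. \<Sum>j<n. x i * Z i j * x j))"

definition sdp_feasible :: "nat \<Rightarrow> nat \<Rightarrow> (nat \<Rightarrow> nat \<Rightarrow> real) \<Rightarrow> bool" where
  "sdp_feasible n K Z \<longleftrightarrow> psd n Z \<and> (\<forall>i<n. Z i i = 1) \<and>
     (\<forall>i<n. \<forall>j<n. 0 \<le> Z i j) \<and> (\<forall>i<n. (\<Sum>j<n. Z i j) = real K)"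

definition sdp_unique_opt :: "nat \<Rightarrow> nat \<Rightarrow> (nat \<Rightarrow> nat \<Rightarrow> real) \<Rightarrow> (nat \<Rightarrow> nat \<Rightarrow> real) \<Rightarrow> bool" where
  "sdp_unique_opt n K A Z0 \<longleftrightarrow> sdp_feasible n K Z0 \<and>
     (\<forall>Z. sdp_feasible n K Z \<and> (\<exists>i<n. \<exists>j<n. Z i j \<noteq> Z0 i j)
          \<longrightarrow> mat_inner n A Z < mat_inner n A Z0)"

end

theory Submission
  imports Defs "HOL-Real_Asymp.Real_Asymp"
begin

text \<open>A dual certificate reduces the theorem to three properties of the graph, with \<open>M\<close> the centred
  adjacency matrix: every vertex has at least \<open>\<eta> log n\<close> more neighbours in its own cluster than in any
  other cluster; all degrees are \<open>O(log n)\<close>; and the sum of \<open>M\<close> over \<open>S \<times> T\<close> is at most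
  \<open>\<alpha> log n sqrt (|S| |T|)\<close> for all vertex sets \<open>S, T\<close>, with \<open>\<alpha>\<close> small compared to \<open>\<eta>\<close>.

  The first property is where \<open>sqrt a - sqrt b > sqrt r\<close> enters, through the Chernoff bound with tilt
  \<open>sqrt (a / b)\<close>. The other two hold by Chernoff and union bounds. Since the certificate has slack
  of order \<open>log n\<close>, the spectral norm of \<open>M\<close> is only needed to be a small multiple of \<open>log n\<close>, rather
  than \<open>O(sqrt (log n))\<close>, and this follows from the degree and discrepancy bounds alone by
  a Bilu--Linial argument.\<close>

section \<open>Positive semidefinite matrices\<close>

definition quad_form :: "'a set \<Rightarrow> ('a \<Rightarrow> 'a \<Rightarrow> real) \<Rightarrow> ('a \<Rightarrow> real) \<Rightarrow> real" where
  "quad_form I M x = (\<Sum>i\<in>I. \<Sum>j\<in>I. x i * M i j * x j)"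

lemma quad_form_add:
  "quad_form I (\<lambda>i j. M i j + N i j) x = quad_form I M x + quad_form I N x"
  by (simp add: quad_form_def sum.distrib algebra_simps)

lemma quad_form_diff:
  "quad_form I (\<lambda>i j. M i j - N i j) x = quad_form I M x - quad_form I N x"
  by (simp add: quad_form_def sum_subtractf algebra_simps)

lemma quad_form_scale: "quad_form I (\<lambda>i j. c * M i j) x = c * quad_form I M x"
  by (simp add: quad_form_def sum_distrib_left mult_ac)

lemma quad_form_transpose: "quad_form I (\<lambda>i j. M j i) x = quad_form I M x"
  unfolding quad_form_def by (subst sum.swap) (simp add: mult_ac)

lemma quad_form_diag:
  assumes "finite I"
  shows "quad_form I (\<lambda>i j. if i = j then d i else 0) x = (\<Sum>i\<in>I. d i * (x i)\<^sup>2)"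
proof -
  have "quad_form I (\<lambda>i j. if i = j then d i else 0) x = (\<Sum>i\<in>I. \<Sum>j\<in>I. if i = j then x i * d i * x i else 0)"
    unfolding quad_form_def by (intro sum.cong) auto
  then show ?thesis using assms by (simp add: power2_eq_square mult_ac)
qed

lemma psd_sym: "psd n Z \<Longrightarrow> i < n \<Longrightarrow> j < n \<Longrightarrow> Z i j = Z j i"
  unfolding psd_def by blast

lemma psd_quad_form_nonneg: "psd n Z \<Longrightarrow> 0 \<le> quad_form {..<n} Z x"
  unfolding psd_def quad_form_def by blast

lemma psdI:
  assumes "\<And>i j. i < n \<Longrightarrow> j < n \<Longrightarrow> Z i j = Z j i"
    and "\<And>x. 0 \<le> quad_form {..<n} Z x"
  shows "psd n Z"
  using assms unfolding psd_def quad_form_def by blast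

lemma psd_entry_le_diag_mean:
  assumes "psd n Z" "i < n" "j < n"
  shows "2 * Z i j \<le> Z i i + Z j j"
proof -
  define x :: "nat \<Rightarrow> real" where "x k = (if k = i then 1 else 0) - (if k = j then 1 else 0)" for k
  have pick: "(\<Sum>k<n. h k * x k) = h i - h j" for h
    using assms(2,3)
    by (simp add: x_def right_diff_distrib sum_subtractf if_distrib[of "times _"] cong: if_cong)
  have "quad_form {..<n} Z x = (\<Sum>k<n. (\<Sum>l<n. Z k l * x l) * x k)"
    by (simp add: quad_form_def sum_distrib_left mult_ac)
  also have "\<dots> = (Z i i - Z i j) - (Z j i - Z j j)"
    unfolding pick ..
  finally show ?thesis
    using psd_quad_form_nonneg[OF assms(1), of x] psd_sym[OF assms] by simp
qed

lemma psd_Suc_bordered_nonneg: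
  assumes "psd (Suc n) Z"
  shows "0 \<le> quad_form {..<n} Z x + 2 * y * (\<Sum>i<n. Z i n * x i) + Z n n * y\<^sup>2"
proof -
  define x' where "x' i = (if i = n then y else x i)" for i
  have "0 \<le> quad_form {..<Suc n} Z x'" using assms by (rule psd_quad_form_nonneg)
  also have "\<dots> = quad_form {..<n} Z x + (\<Sum>i<n. x i * Z i n * y) + (\<Sum>j<n. y * Z n j * x j) + y * Z n n * y"
    by (simp add: quad_form_def x'_def sum.distrib)
  also have "(\<Sum>j<n. y * Z n j * x j) = (\<Sum>i<n. x i * Z i n * y)"
    using psd_sym[OF assms] by (intro sum.cong) auto
  also have "(\<Sum>i<n. x i * Z i n * y) = y * (\<Sum>i<n. Z i n * x i)"
    by (simp add: sum_distrib_left mult_ac)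
  finally show ?thesis by (simp add: power2_eq_square algebra_simps)
qed

lemma psd_principal_submatrix: "psd (Suc n) Z \<Longrightarrow> psd n Z"
  using psd_Suc_bordered_nonneg[of n Z _ 0] by (intro psdI) (auto intro: psd_sym)

lemma psd_column_eq_0:
  assumes psd: "psd (Suc n) Z" and corner: "Z n n = 0" and i: "i < n"
  shows "Z i n = 0"
proof (rule ccontr)
  assume nonzero: "Z i n \<noteq> 0"
  define e :: "nat \<Rightarrow> real" where "e j = (if j = i then 1 else 0)" for j
  have "(\<Sum>j<n. Z j n * e j) = Z i n"
    using i by (simp add: e_def if_distrib cong: if_cong)
  then have "0 \<le> quad_form {..<n} Z e + 2 * y * Z i n" for y
    using psd_Suc_bordered_nonneg[OF psd, of e y] corner by simp
  from this[of "- (quad_form {..<n} Z e + 1) / (2 * Z i n)"] nonzero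
  show False by (simp add: field_simps)
qed

lemma psd_schur_complement:
  assumes psd: "psd (Suc n) Z"
  shows "psd n (\<lambda>i j. Z i j - Z i n * Z j n / Z n n)"
proof (rule psdI)
  show "Z i j - Z i n * Z j n / Z n n = Z j i - Z j n * Z i n / Z n n" if "i < n" "j < n" for i j
    using psd_sym[OF psd, of i j] that by simp
  fix x
  define s where "s = (\<Sum>i<n. Z i n * x i)"
  have "quad_form {..<n} (\<lambda>i j. Z i n * Z j n / Z n n) x = s\<^sup>2 / Z n n"
    by (simp add: quad_form_def s_def power2_eq_square sum_product sum_divide_distrib mult_ac)
  then have "quad_form {..<n} (\<lambda>i j. Z i j - Z i n * Z j n / Z n n) x
      = quad_form {..<n} Z x + 2 * (- s / Z n n) * s + Z n n * (- s / Z n n)\<^sup>2"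
    unfolding quad_form_diff by (cases "Z n n = 0") (simp_all add: field_simps power2_eq_square)
  then show "0 \<le> quad_form {..<n} (\<lambda>i j. Z i j - Z i n * Z j n / Z n n) x"
    using psd_Suc_bordered_nonneg[OF psd, of x "- s / Z n n"] by (simp add: s_def)
qed

lemma psd_imp_mat_inner_nonneg:
  "psd n S \<Longrightarrow> psd n Z \<Longrightarrow> 0 \<le> mat_inner n S Z"
proof (induction n arbitrary: Z)
  case 0
  then show ?case by (simp add: mat_inner_def)
next
  case (Suc n)
  define Z' where "Z' i j = Z i j - Z i n * Z j n / Z n n" for i j
  have border: "Z' i n = 0" "Z' n i = 0" if "i \<le> n" for i
    using that psd_column_eq_0[OF Suc.prems(2), of i] psd_sym[OF Suc.prems(2), of n i]
    by (cases "i = n"; cases "Z n n = 0"; simp add: Z'_def)+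
  have corner: "Z n n \<ge> 0"
    using psd_Suc_bordered_nonneg[OF Suc.prems(2), of "\<lambda>_. 0" 1] by (simp add: quad_form_def)
  have "mat_inner (Suc n) S Z
      = mat_inner (Suc n) S Z' + (\<Sum>i<Suc n. \<Sum>j<Suc n. S i j * (Z i n * Z j n / Z n n))"
    unfolding mat_inner_def sum.distrib[symmetric]
    by (intro sum.cong refl) (simp add: Z'_def algebra_simps)
  also have "mat_inner (Suc n) S Z' = mat_inner n S Z'"
    by (simp add: mat_inner_def border)
  also have "(\<Sum>i<Suc n. \<Sum>j<Suc n. S i j * (Z i n * Z j n / Z n n)) = quad_form {..<Suc n} S (\<lambda>i. Z i n) / Z n n"
    unfolding quad_form_def sum_divide_distrib by (intro sum.cong refl) simp
  finally show ?case
    using Suc.IH[OF psd_principal_submatrix[OF Suc.prems(1)] psd_schur_complement[OF Suc.prems(2)]]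
      psd_quad_form_nonneg[OF Suc.prems(1)] corner
    by (simp add: Z'_def)
qed

section \<open>Discrepancy and quadratic forms\<close>

definition block_sum :: "('a \<Rightarrow> 'b \<Rightarrow> real) \<Rightarrow> 'a set \<Rightarrow> 'b set \<Rightarrow> real" where
  "block_sum M S T = (\<Sum>i\<in>S. \<Sum>j\<in>T. M i j)"

definition discrepancy_le :: "'a set \<Rightarrow> ('a \<Rightarrow> 'a \<Rightarrow> real) \<Rightarrow> real \<Rightarrow> bool" where
  "discrepancy_le I M \<beta> \<longleftrightarrow> (\<forall>S T. S \<subseteq> I \<longrightarrow> T \<subseteq> I \<longrightarrow>
     \<bar>block_sum M S T\<bar> \<le> \<beta> * sqrt (real (card S) * real (card T)))"

definition comparable_cards :: "real \<Rightarrow> 'a set \<Rightarrow> 'a set \<Rightarrow> bool" where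
  "comparable_cards \<epsilon> S T \<longleftrightarrow> card S \<le> card T \<and> \<epsilon>\<^sup>2 * card T \<le> card S"

definition comparable_discrepancy_le :: "'a set \<Rightarrow> real \<Rightarrow> ('a \<Rightarrow> 'a \<Rightarrow> real) \<Rightarrow> real \<Rightarrow> bool" where
  "comparable_discrepancy_le I \<epsilon> M \<beta> \<longleftrightarrow> (\<forall>S T. S \<subseteq> I \<longrightarrow> T \<subseteq> I \<longrightarrow> comparable_cards \<epsilon> S T \<longrightarrow>
     \<bar>block_sum M S T\<bar> \<le> \<beta> * sqrt (real (card S) * real (card T)))"

lemma block_sum_diff: "block_sum (\<lambda>i j. M i j - N i j) S T = block_sum M S T - block_sum N S T"
  by (simp add: block_sum_def sum_subtractf)

lemma block_sum_transpose: "block_sum (\<lambda>i j. M j i) T S = block_sum M S T"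
  unfolding block_sum_def by (rule sum.swap)

lemma discrepancy_leD:
  assumes "discrepancy_le I M \<beta>" "S \<subseteq> I" "T \<subseteq> I"
  shows "\<bar>block_sum M S T\<bar> \<le> \<beta> * sqrt (real (card S) * real (card T))"
  using assms unfolding discrepancy_le_def by blast

lemma discrepancy_le_subset: "discrepancy_le I M \<beta> \<Longrightarrow> J \<subseteq> I \<Longrightarrow> discrepancy_le J M \<beta>"
  unfolding discrepancy_le_def by blast

lemma comparable_imp_discrepancy_le:
  assumes I: "finite I" and sym: "\<And>i j. i \<in> I \<Longrightarrow> j \<in> I \<Longrightarrow> M i j = M j i"
    and row: "\<And>i. i \<in> I \<Longrightarrow> (\<Sum>j\<in>I. \<bar>M i j\<bar>) \<le> d"
    and d: "d > 0" and \<beta>: "\<beta> \<ge> 0"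
    and disc: "comparable_discrepancy_le I (\<beta> / d) M \<beta>"
  shows "discrepancy_le I M \<beta>"
proof -
  have ordered: "\<bar>block_sum M S T\<bar> \<le> \<beta> * sqrt (real (card S) * real (card T))"
    if S: "S \<subseteq> I" and T: "T \<subseteq> I" and le: "card S \<le> card T" for S T
  proof (cases "comparable_cards (\<beta> / d) S T")
    case True
    with disc S T show ?thesis unfolding comparable_discrepancy_le_def by blast
  next
    case False
    then have small: "real (card S) \<le> (\<beta> / d)\<^sup>2 * card T" using le by (simp add: comparable_cards_def)
    have "\<bar>block_sum M S T\<bar> \<le> (\<Sum>i\<in>S. \<Sum>j\<in>T. \<bar>M i j\<bar>)"
      unfolding block_sum_def by (intro order.trans[OF sum_abs] sum_mono sum_abs)
    also have "\<dots> \<le> (\<Sum>i\<in>S. \<Sum>j\<in>I. \<bar>M i j\<bar>)"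
      using T I by (intro sum_mono sum_mono2) auto
    also have "\<dots> \<le> (\<Sum>i\<in>S. d)" using row S by (intro sum_mono) auto
    also have "\<dots> = d * sqrt (real (card S) * card S)" by simp
    also have "\<dots> \<le> d * sqrt (real (card S) * ((\<beta> / d)\<^sup>2 * card T))"
      using small d by (intro mult_left_mono real_sqrt_le_mono) auto
    also have "\<dots> = \<beta> * sqrt (real (card S) * real (card T))"
      using d \<beta> by (simp add: real_sqrt_mult real_sqrt_divide)
    finally show ?thesis .
  qed
  show ?thesis unfolding discrepancy_le_def
  proof (intro allI impI)
    fix S T assume ST: "S \<subseteq> I" "T \<subseteq> I"
    have "block_sum M S T = block_sum (\<lambda>i j. M j i) S T"
      unfolding block_sum_def using ST by (intro sum.cong sym) auto
    also have "\<dots> = block_sum M T S" by (rule block_sum_transpose)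
    finally show "\<bar>block_sum M S T\<bar> \<le> \<beta> * sqrt (real (card S) * real (card T))"
      using ordered[OF ST] ordered[OF ST(2,1)] by (cases "card S \<le> card T") (simp_all add: mult.commute)
  qed
qed

lemma abs_weighted_sum_le:
  fixes g u :: "'a \<Rightarrow> real"
  assumes S: "finite S" and u: "\<And>i. i \<in> S \<Longrightarrow> \<bar>u i\<bar> \<le> 1"
    and sub: "\<And>S'. S' \<subseteq> S \<Longrightarrow> \<bar>\<Sum>i\<in>S'. g i\<bar> \<le> c"
  shows "\<bar>\<Sum>i\<in>S. u i * g i\<bar> \<le> 2 * c"
proof -
  have "\<bar>\<Sum>i\<in>S. u i * g i\<bar> \<le> (\<Sum>i\<in>S. \<bar>g i\<bar>)"
    using u by (intro order.trans[OF sum_abs] sum_mono) (auto simp: abs_mult intro!: mult_left_le_one_le)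
  also have "\<dots> = (\<Sum>i\<in>S. if g i \<ge> 0 then g i else 0) - (\<Sum>i\<in>S. if g i < 0 then g i else 0)"
    unfolding sum_subtractf[symmetric] by (intro sum.cong) auto
  also have "\<dots> = (\<Sum>i\<in>{i\<in>S. g i \<ge> 0}. g i) - (\<Sum>i\<in>{i\<in>S. g i < 0}. g i)"
    unfolding sum.inter_filter[OF S] ..
  finally show ?thesis
    using sub[of "{i\<in>S. g i \<ge> 0}"] sub[of "{i\<in>S. g i < 0}"] by auto
qed

lemma abs_weighted_block_sum_le:
  assumes "finite S" "finite T"
    and u: "\<And>i. i \<in> S \<Longrightarrow> \<bar>u i\<bar> \<le> 1" and v: "\<And>j. j \<in> T \<Longrightarrow> \<bar>v j\<bar> \<le> 1"
    and sub: "\<And>S' T'. S' \<subseteq> S \<Longrightarrow> T' \<subseteq> T \<Longrightarrow> \<bar>block_sum M S' T'\<bar> \<le> c"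
  shows "\<bar>\<Sum>i\<in>S. \<Sum>j\<in>T. u i * M i j * v j\<bar> \<le> 4 * c"
proof -
  have "\<bar>\<Sum>j\<in>T. v j * (\<Sum>i\<in>S. u i * M i j)\<bar> \<le> 2 * (2 * c)"
  proof (intro abs_weighted_sum_le assms)
    fix T' assume T': "T' \<subseteq> T"
    have "(\<Sum>j\<in>T'. \<Sum>i\<in>S. u i * M i j) = (\<Sum>i\<in>S. u i * (\<Sum>j\<in>T'. M i j))"
      by (subst sum.swap) (simp add: sum_distrib_left)
    then show "\<bar>\<Sum>j\<in>T'. \<Sum>i\<in>S. u i * M i j\<bar> \<le> 2 * c"
      using abs_weighted_sum_le[OF \<open>finite S\<close> u, where g = "\<lambda>i. \<Sum>j\<in>T'. M i j" and c = c] sub T'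
      by (simp add: block_sum_def)
  qed
  also have "(\<Sum>j\<in>T. v j * (\<Sum>i\<in>S. u i * M i j)) = (\<Sum>i\<in>S. \<Sum>j\<in>T. u i * M i j * v j)"
    by (subst sum.swap) (simp add: sum_distrib_left mult_ac)
  finally show ?thesis by simp
qed

definition dyadic_level :: "real \<Rightarrow> int" where
  "dyadic_level y = \<lfloor>log 2 \<bar>y\<bar>\<rfloor>"

definition level_set :: "'a set \<Rightarrow> ('a \<Rightarrow> real) \<Rightarrow> int \<Rightarrow> 'a set" where
  "level_set I x k = {i \<in> I. dyadic_level (x i) = k}"

definition near_levels :: "nat \<Rightarrow> real \<Rightarrow> real \<Rightarrow> bool" where
  "near_levels R y z \<longleftrightarrow> \<bar>dyadic_level y - dyadic_level z\<bar> \<le> int R"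

lemma dyadic_level_bounds:
  assumes "y \<noteq> 0"
  shows "2 powr dyadic_level y \<le> \<bar>y\<bar>" "\<bar>y\<bar> \<le> 2 * 2 powr dyadic_level y"
proof -
  have y: "\<bar>y\<bar> = 2 powr (log 2 \<bar>y\<bar>)" using assms by simp
  show "2 powr dyadic_level y \<le> \<bar>y\<bar>"
    unfolding dyadic_level_def by (subst (2) y, rule powr_mono) auto
  have "\<bar>y\<bar> \<le> 2 powr (1 + dyadic_level y)"
    unfolding dyadic_level_def by (subst (1) y, rule powr_mono) linarith+
  then show "\<bar>y\<bar> \<le> 2 * 2 powr dyadic_level y" by (simp add: powr_add)
qed

lemma level_set_mass_ge:
  assumes nonzero: "\<And>i. i \<in> I \<Longrightarrow> x i \<noteq> 0"
  shows "2 powr k * sqrt (card (level_set I x k)) \<le> sqrt (\<Sum>i\<in>level_set I x k. (x i)\<^sup>2)"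
proof (rule real_le_rsqrt)
  have "(2 powr k * sqrt (card (level_set I x k)))\<^sup>2 = (\<Sum>i\<in>level_set I x k. (2 powr k)\<^sup>2)"
    by (simp add: power_mult_distrib)
  also have "\<dots> \<le> (\<Sum>i\<in>level_set I x k. \<bar>x i\<bar>\<^sup>2)"
    using dyadic_level_bounds(1) nonzero
    by (intro sum_mono power_mono) (auto simp: level_set_def)
  finally show "(2 powr k * sqrt (card (level_set I x k)))\<^sup>2 \<le> (\<Sum>i\<in>level_set I x k. (x i)\<^sup>2)" by simp
qed

lemma discrepancy_imp_level_block_le:
  assumes I: "finite I" and nonzero: "\<And>i. i \<in> I \<Longrightarrow> x i \<noteq> 0"
    and disc: "discrepancy_le I M \<beta>" and \<beta>: "\<beta> \<ge> 0"
  shows "(\<Sum>i\<in>level_set I x k. \<Sum>j\<in>level_set I x l. x i * M i j * x j)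
    \<le> 8 * \<beta> * ((\<Sum>i\<in>level_set I x k. (x i)\<^sup>2) + (\<Sum>j\<in>level_set I x l. (x j)\<^sup>2))"
proof -
  define S where "S = level_set I x"
  define w where "w k = (\<Sum>i\<in>S k. (x i)\<^sup>2)" for k
  define u where "u k i = x i / (2 * 2 powr k)" for k i
  define c where "c = \<beta> * sqrt (real (card (S k)) * real (card (S l)))"
  have S: "finite (S k)" "S k \<subseteq> I" for k using I by (auto simp: S_def level_set_def)
  have w_nonneg: "w k \<ge> 0" for k by (simp add: w_def sum_nonneg)
  have mass: "2 powr k * sqrt (card (S k)) \<le> sqrt (w k)" for k :: int
    unfolding S_def w_def using nonzero by (rule level_set_mass_ge)
  have u_le: "\<bar>u k i\<bar> \<le> 1" if "i \<in> S k" for k i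
    using dyadic_level_bounds(2)[of "x i"] nonzero that by (auto simp: u_def S_def level_set_def)
  have "\<bar>\<Sum>i\<in>S k. \<Sum>j\<in>S l. u k i * M i j * u l j\<bar> \<le> 4 * c"
  proof (rule abs_weighted_block_sum_le[OF S(1) S(1) u_le u_le])
    fix S' T' assume sub: "S' \<subseteq> S k" "T' \<subseteq> S l"
    then have "\<bar>block_sum M S' T'\<bar> \<le> \<beta> * sqrt (real (card S') * real (card T'))"
      using S(2) by (intro discrepancy_leD[OF disc]) blast+
    also have "\<dots> \<le> c" unfolding c_def using \<beta> sub S(1)
      by (intro mult_left_mono real_sqrt_le_mono mult_mono) (auto intro: card_mono)
    finally show "\<bar>block_sum M S' T'\<bar> \<le> c" .
  qed
  moreover have "(\<Sum>i\<in>S k. \<Sum>j\<in>S l. x i * M i j * x j)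
      = (4 * 2 powr k * 2 powr l) * (\<Sum>i\<in>S k. \<Sum>j\<in>S l. u k i * M i j * u l j)"
    by (simp add: sum_distrib_left u_def field_simps)
  ultimately have "(\<Sum>i\<in>S k. \<Sum>j\<in>S l. x i * M i j * x j) \<le> (4 * 2 powr k * 2 powr l) * (4 * c)"
    by (simp add: mult_left_mono)
  also have "\<dots> = 16 * \<beta> * ((2 powr k * sqrt (card (S k))) * (2 powr l * sqrt (card (S l))))"
    by (simp add: c_def real_sqrt_mult)
  also have "\<dots> \<le> 16 * \<beta> * (sqrt (w k) * sqrt (w l))"
    using \<beta> mass w_nonneg by (intro mult_left_mono mult_mono) auto
  also have "\<dots> \<le> 16 * \<beta> * ((w k + w l) / 2)"
    using \<beta> w_nonneg arith_geo_mean_sqrt[of "w k" "w l"]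
    by (intro mult_left_mono) (auto simp: real_sqrt_mult)
  finally show ?thesis by (simp add: S_def w_def)
qed

lemma sum_near_integers_le:
  fixes w :: "int \<Rightarrow> real"
  assumes \<Lambda>: "finite \<Lambda>" and w: "\<And>k. w k \<ge> 0"
  shows "(\<Sum>k\<in>\<Lambda>. \<Sum>l\<in>\<Lambda>. if \<bar>k - l\<bar> \<le> int R then w k else 0) \<le> (2 * R + 1) * (\<Sum>k\<in>\<Lambda>. w k)"
proof -
  have near_count: "(\<Sum>l\<in>\<Lambda>. if \<bar>k - l\<bar> \<le> int R then 1 else 0 :: real) \<le> 2 * R + 1" for k
  proof -
    have "card {l \<in> \<Lambda>. \<bar>k - l\<bar> \<le> int R} \<le> card {k - int R..k + int R}"
      by (intro card_mono) auto
    also have "\<dots> = 2 * R + 1" by simp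
    finally show ?thesis using \<Lambda> by (simp add: sum.If_cases Int_def)
  qed
  have "(\<Sum>k\<in>\<Lambda>. \<Sum>l\<in>\<Lambda>. if \<bar>k - l\<bar> \<le> int R then w k else 0)
      = (\<Sum>k\<in>\<Lambda>. w k * (\<Sum>l\<in>\<Lambda>. if \<bar>k - l\<bar> \<le> int R then 1 else 0))"
    unfolding sum_distrib_left by (intro sum.cong) auto
  also have "\<dots> \<le> (\<Sum>k\<in>\<Lambda>. w k * (2 * R + 1))"
    using near_count w by (intro sum_mono mult_left_mono)
  finally show ?thesis by (simp add: sum_distrib_right[symmetric] mult.commute add.commute)
qed

lemma sum_near_levels_le:
  assumes I: "finite I" and nonzero: "\<And>i. i \<in> I \<Longrightarrow> x i \<noteq> 0"
    and disc: "discrepancy_le I M \<beta>" and \<beta>: "\<beta> \<ge> 0"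
  shows "(\<Sum>i\<in>I. \<Sum>j\<in>I. if near_levels R (x i) (x j) then x i * M i j * x j else 0)
    \<le> 16 * \<beta> * (2 * R + 1) * (\<Sum>i\<in>I. (x i)\<^sup>2)"
proof -
  define \<Lambda> where "\<Lambda> = (\<lambda>i. dyadic_level (x i)) ` I"
  define S where "S = level_set I x"
  define w where "w k = (\<Sum>i\<in>S k. (x i)\<^sup>2)" for k
  have \<Lambda>: "finite \<Lambda>" using I by (simp add: \<Lambda>_def)
  have by_level: "(\<Sum>k\<in>\<Lambda>. \<Sum>i\<in>S k. h i) = (\<Sum>i\<in>I. h i)" for h :: "'a \<Rightarrow> real"
    unfolding S_def level_set_def \<Lambda>_def using I by (intro sum.group) auto
  have w_mass: "(\<Sum>k\<in>\<Lambda>. w k) = (\<Sum>i\<in>I. (x i)\<^sup>2)" by (simp add: w_def by_level)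
  have w_nonneg: "w k \<ge> 0" for k by (simp add: w_def sum_nonneg)
  have "(\<Sum>i\<in>I. \<Sum>j\<in>I. if near_levels R (x i) (x j) then x i * M i j * x j else 0)
      = (\<Sum>k\<in>\<Lambda>. \<Sum>i\<in>S k. \<Sum>l\<in>\<Lambda>. \<Sum>j\<in>S l.
          if near_levels R (x i) (x j) then x i * M i j * x j else 0)"
    by (simp only: by_level)
  also have "\<dots> = (\<Sum>k\<in>\<Lambda>. \<Sum>l\<in>\<Lambda>. \<Sum>i\<in>S k. \<Sum>j\<in>S l.
          if near_levels R (x i) (x j) then x i * M i j * x j else 0)"
    by (intro sum.cong refl sum.swap)
  also have "\<dots> = (\<Sum>k\<in>\<Lambda>. \<Sum>l\<in>\<Lambda>. if \<bar>k - l\<bar> \<le> int R then \<Sum>i\<in>S k. \<Sum>j\<in>S l. x i * M i j * x j else 0)"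
    by (intro sum.cong refl) (auto simp: S_def level_set_def near_levels_def intro!: sum.neutral)
  also have "\<dots> \<le> (\<Sum>k\<in>\<Lambda>. \<Sum>l\<in>\<Lambda>. 8 * \<beta> * (if \<bar>k - l\<bar> \<le> int R then w k else 0)
      + 8 * \<beta> * (if \<bar>l - k\<bar> \<le> int R then w l else 0))"
    using discrepancy_imp_level_block_le[OF I nonzero disc \<beta>]
    by (intro sum_mono) (auto simp: S_def w_def distrib_left abs_minus_commute)
  also have "\<dots> = 16 * \<beta> * (\<Sum>k\<in>\<Lambda>. \<Sum>l\<in>\<Lambda>. if \<bar>k - l\<bar> \<le> int R then w k else 0)"
    unfolding sum.distrib sum_distrib_left[symmetric] by (subst (2) sum.swap) simp
  also have "\<dots> \<le> 16 * \<beta> * ((2 * R + 1) * (\<Sum>i\<in>I. (x i)\<^sup>2))"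
    using sum_near_integers_le[where w = w and R = R, OF \<Lambda> w_nonneg] \<beta>
    unfolding w_mass by (intro mult_left_mono) (auto simp: add.commute)
  finally show ?thesis by (simp add: mult.assoc)
qed

lemma far_levels_imp_abs_mult_le:
  assumes "\<not> near_levels R y z"
  shows "\<bar>y * z\<bar> \<le> (y\<^sup>2 + z\<^sup>2) / 2 ^ R"
proof -
  have ordered: "\<bar>y * z\<bar> \<le> (y\<^sup>2 + z\<^sup>2) / 2 ^ R"
    if "int R < dyadic_level y - dyadic_level z" "y \<noteq> 0" "z \<noteq> 0" for y z
  proof -
    have "\<bar>z\<bar> \<le> 2 powr (1 + dyadic_level z)"
      using dyadic_level_bounds(2)[OF \<open>z \<noteq> 0\<close>] by (simp add: powr_add)
    also have "\<dots> \<le> 2 powr (dyadic_level y - real R)"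
      using that(1) by (intro powr_mono) linarith+
    also have "\<dots> = 2 powr dyadic_level y / 2 ^ R" by (simp add: powr_diff powr_realpow)
    also have "\<dots> \<le> \<bar>y\<bar> / 2 ^ R"
      using dyadic_level_bounds(1)[OF \<open>y \<noteq> 0\<close>] by (simp add: divide_right_mono)
    finally have "\<bar>y\<bar> * \<bar>z\<bar> \<le> \<bar>y\<bar> * (\<bar>y\<bar> / 2 ^ R)" by (intro mult_left_mono) auto
    also have "\<dots> \<le> (y\<^sup>2 + z\<^sup>2) / 2 ^ R" by (simp add: power2_eq_square divide_right_mono)
    finally show ?thesis by (simp add: abs_mult)
  qed
  show ?thesis
  proof (cases "y = 0 \<or> z = 0")
    case False
    then show ?thesis
      using assms ordered[of y z] ordered[of z y]
      by (cases "dyadic_level y \<ge> dyadic_level z") (auto simp: near_levels_def mult.commute add.commute)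
  qed auto
qed

lemma sum_far_levels_le:
  assumes sym: "\<And>i j. i \<in> I \<Longrightarrow> j \<in> I \<Longrightarrow> M i j = M j i" and row: "\<And>i. i \<in> I \<Longrightarrow> (\<Sum>j\<in>I. \<bar>M i j\<bar>) \<le> d"
  shows "(\<Sum>i\<in>I. \<Sum>j\<in>I. if near_levels R (x i) (x j) then 0 else x i * M i j * x j)
    \<le> 2 * d / 2 ^ R * (\<Sum>i\<in>I. (x i)\<^sup>2)"
proof -
  have entry: "(if near_levels R (x i) (x j) then 0 else x i * M i j * x j)
      \<le> \<bar>M i j\<bar> * (((x i)\<^sup>2 + (x j)\<^sup>2) / 2 ^ R)" for i j
  proof (cases "near_levels R (x i) (x j)")
    case False
    have "x i * M i j * x j \<le> \<bar>M i j\<bar> * \<bar>x i * x j\<bar>"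
      by (metis abs_ge_self abs_mult mult.assoc mult.commute)
    also have "\<dots> \<le> \<bar>M i j\<bar> * (((x i)\<^sup>2 + (x j)\<^sup>2) / 2 ^ R)"
      using False by (intro mult_left_mono far_levels_imp_abs_mult_le) auto
    finally show ?thesis using False by simp
  qed simp
  have "(\<Sum>i\<in>I. \<Sum>j\<in>I. if near_levels R (x i) (x j) then 0 else x i * M i j * x j)
      \<le> (\<Sum>i\<in>I. \<Sum>j\<in>I. \<bar>M i j\<bar> * (((x i)\<^sup>2 + (x j)\<^sup>2) / 2 ^ R))"
    by (intro sum_mono entry)
  also have "\<dots> = ((\<Sum>i\<in>I. \<Sum>j\<in>I. \<bar>M i j\<bar> * (x i)\<^sup>2) + (\<Sum>i\<in>I. \<Sum>j\<in>I. \<bar>M i j\<bar> * (x j)\<^sup>2)) / 2 ^ R"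
    by (simp add: sum.distrib[symmetric] sum_divide_distrib distrib_left)
  also have "(\<Sum>i\<in>I. \<Sum>j\<in>I. \<bar>M i j\<bar> * (x j)\<^sup>2) = (\<Sum>i\<in>I. \<Sum>j\<in>I. \<bar>M i j\<bar> * (x i)\<^sup>2)"
    by (subst sum.swap) (intro sum.cong refl, simp add: sym)
  also have "(\<Sum>i\<in>I. \<Sum>j\<in>I. \<bar>M i j\<bar> * (x i)\<^sup>2) \<le> (\<Sum>i\<in>I. d * (x i)\<^sup>2)"
    unfolding sum_distrib_right[symmetric] using row by (intro sum_mono mult_right_mono) auto
  finally show ?thesis by (simp add: sum_distrib_left[symmetric] divide_right_mono)
qed

text \<open>A converse of the expander mixing lemma in the style of Bilu and Linial: entries between dyadic
  levels of \<open>x\<close> at distance at most \<open>R\<close> are controlled by the discrepancy, the others by the row sums.\<close>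

lemma discrepancy_imp_quad_form_le:
  assumes I: "finite I" and sym: "\<And>i j. i \<in> I \<Longrightarrow> j \<in> I \<Longrightarrow> M i j = M j i"
    and row: "\<And>i. i \<in> I \<Longrightarrow> (\<Sum>j\<in>I. \<bar>M i j\<bar>) \<le> d"
    and disc: "discrepancy_le I M \<beta>" and \<beta>: "\<beta> \<ge> 0"
  shows "quad_form I M x \<le> (16 * \<beta> * (2 * real R + 1) + 2 * d / 2 ^ R) * (\<Sum>i\<in>I. (x i)\<^sup>2)"
proof -
  define J where "J = {i \<in> I. x i \<noteq> 0}"
  have J: "finite J" "J \<subseteq> I" and nonzero: "\<And>i. i \<in> J \<Longrightarrow> x i \<noteq> 0" using I by (auto simp: J_def)
  have symJ: "M i j = M j i" if "i \<in> J" "j \<in> J" for i j using that J by (intro sym) auto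
  have rowJ: "(\<Sum>j\<in>J. \<bar>M i j\<bar>) \<le> d" if "i \<in> J" for i
    using that J sum_mono2[OF I J(2), of "\<lambda>j. \<bar>M i j\<bar>"] row[of i] by force
  have "quad_form I M x = (\<Sum>i\<in>J. \<Sum>j\<in>I. x i * M i j * x j)"
    unfolding quad_form_def using I by (intro sum.mono_neutral_right) (auto simp: J_def)
  also have "\<dots> = (\<Sum>i\<in>J. \<Sum>j\<in>J. x i * M i j * x j)"
    using I by (intro sum.cong sum.mono_neutral_right) (auto simp: J_def)
  also have "\<dots> = (\<Sum>i\<in>J. \<Sum>j\<in>J. if near_levels R (x i) (x j) then x i * M i j * x j else 0)
      + (\<Sum>i\<in>J. \<Sum>j\<in>J. if near_levels R (x i) (x j) then 0 else x i * M i j * x j)"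
    unfolding sum.distrib[symmetric] by (intro sum.cong) auto
  also have "\<dots> \<le> 16 * \<beta> * (2 * real R + 1) * (\<Sum>i\<in>J. (x i)\<^sup>2) + 2 * d / 2 ^ R * (\<Sum>i\<in>J. (x i)\<^sup>2)"
    using sum_near_levels_le[OF J(1) nonzero discrepancy_le_subset[OF disc J(2)] \<beta>, where R = R]
      sum_far_levels_le[OF symJ rowJ, where x = x and R = R] by (intro add_mono) (simp_all add: add.commute)
  also have "(\<Sum>i\<in>J. (x i)\<^sup>2) = (\<Sum>i\<in>I. (x i)\<^sup>2)"
    using I by (intro sum.mono_neutral_left) (auto simp: J_def)
  finally show ?thesis by (simp add: distrib_right)
qed

section \<open>Optimality certificates for the cluster matrix\<close>

lemma sdp_feasible_entry_le_1:
  assumes "sdp_feasible n K Z" "i < n" "j < n"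
  shows "Z i j \<le> 1"
  using assms psd_entry_le_diag_mean[of n Z i j] unfolding sdp_feasible_def by auto

lemma mat_inner_eq_dual_value:
  assumes Z: "sdp_feasible n K Z"
    and A: "\<And>i j. i < n \<Longrightarrow> j < n \<Longrightarrow>
      A i j = (if i = j then d i else 0) + lam i + lam j - B i j - S i j"
  shows "mat_inner n A Z = (\<Sum>i<n. d i) + 2 * K * (\<Sum>i<n. lam i) - mat_inner n B Z - mat_inner n S Z"
proof -
  have sym: "Z i j = Z j i" if "i < n" "j < n" for i j
    using Z that psd_sym unfolding sdp_feasible_def by blast
  have diag: "Z i i = 1" if "i < n" for i using Z that unfolding sdp_feasible_def by blast
  have row: "(\<Sum>j<n. Z i j) = K" if "i < n" for i using Z that unfolding sdp_feasible_def by blast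
  have rows: "(\<Sum>i<n. \<Sum>j<n. lam i * Z i j) = K * (\<Sum>i<n. lam i)"
    by (simp add: sum_distrib_left[symmetric] sum_distrib_right[symmetric] row mult.commute)
  have cols: "(\<Sum>i<n. \<Sum>j<n. lam j * Z i j) = K * (\<Sum>i<n. lam i)"
    unfolding rows[symmetric] by (subst sum.swap) (intro sum.cong refl, simp add: sym)
  have "mat_inner n A Z = (\<Sum>i<n. \<Sum>j<n. (if i = j then d i * Z i j else 0) + lam i * Z i j + lam j * Z i j
      - B i j * Z i j - S i j * Z i j)"
    unfolding mat_inner_def by (intro sum.cong refl) (auto simp: A algebra_simps)
  also have "\<dots> = (\<Sum>i<n. \<Sum>j<n. if i = j then d i * Z i j else 0) + (\<Sum>i<n. \<Sum>j<n. lam i * Z i j)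
      + (\<Sum>i<n. \<Sum>j<n. lam j * Z i j) - mat_inner n B Z - mat_inner n S Z"
    by (simp add: mat_inner_def sum.distrib sum_subtractf)
  also have "(\<Sum>i<n. \<Sum>j<n. if i = j then d i * Z i j else 0) = (\<Sum>i<n. d i)"
    by (simp add: diag)
  finally show ?thesis unfolding rows cols by simp
qed

locale balanced_clustering =
  fixes n r K :: nat and \<sigma> :: "nat \<Rightarrow> nat"
  assumes n_eq: "n = r * K" and balanced: "balanced_labelling r K \<sigma>"
begin

definition cluster :: "nat \<Rightarrow> nat set" where
  "cluster l = {j. j < n \<and> \<sigma> j = l}"

definition cluster_degree :: "(nat \<Rightarrow> nat \<Rightarrow> real) \<Rightarrow> nat \<Rightarrow> nat \<Rightarrow> real" where
  "cluster_degree A i l = (\<Sum>j\<in>cluster l. A i j)"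

definition cluster_gap :: "(nat \<Rightarrow> nat \<Rightarrow> real) \<Rightarrow> real \<Rightarrow> bool" where
  "cluster_gap A g \<longleftrightarrow> (\<forall>i<n. \<forall>l<r. l \<noteq> \<sigma> i \<longrightarrow> cluster_degree A i l + g \<le> cluster_degree A i (\<sigma> i))"

definition cluster_centred :: "(nat \<Rightarrow> real) \<Rightarrow> bool" where
  "cluster_centred w \<longleftrightarrow> (\<forall>l<r. (\<Sum>j\<in>cluster l. w j) = 0)"

definition cluster_mean :: "(nat \<Rightarrow> real) \<Rightarrow> nat \<Rightarrow> real" where
  "cluster_mean v l = (\<Sum>j\<in>cluster l. v j) / K"

lemma label_less: "i < n \<Longrightarrow> \<sigma> i < r"
  using balanced unfolding balanced_labelling_def n_eq[symmetric] by blast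

lemma card_cluster: "l < r \<Longrightarrow> card (cluster l) = K"
  using balanced unfolding balanced_labelling_def cluster_def n_eq[symmetric] by blast

lemma finite_cluster [simp]: "finite (cluster l)"
  by (simp add: cluster_def)

lemma cluster_subset: "cluster l \<subseteq> {..<n}"
  by (auto simp: cluster_def)

lemma mem_cluster_iff [simp]: "i \<in> cluster l \<longleftrightarrow> i < n \<and> \<sigma> i = l"
  by (simp add: cluster_def)

lemma sum_clusters: "(\<Sum>l<r. \<Sum>j\<in>cluster l. h j) = (\<Sum>j<n. h j :: real)"
proof -
  have "(\<Sum>l<r. \<Sum>j | j \<in> {..<n} \<and> \<sigma> j = l. h j) = (\<Sum>j<n. h j)"
    using label_less by (intro sum.group) auto
  then show ?thesis by (simp add: cluster_def)
qed

lemma sum_cluster_matrix: "(\<Sum>j<n. h j * cluster_matrix \<sigma> i j) = (\<Sum>j\<in>cluster (\<sigma> i). h j)"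
  by (rule sum.mono_neutral_cong_right) (auto simp: cluster_matrix_def)

lemma cluster_matrix_feasible: "sdp_feasible n K (cluster_matrix \<sigma>)"
proof -
  have "psd n (cluster_matrix \<sigma>)"
  proof (rule psdI)
    fix x
    have "quad_form {..<n} (cluster_matrix \<sigma>) x = (\<Sum>i<n. x i * (\<Sum>j<n. x j * cluster_matrix \<sigma> i j))"
      by (simp add: quad_form_def sum_distrib_left mult_ac)
    also have "\<dots> = (\<Sum>l<r. \<Sum>i\<in>cluster l. x i * (\<Sum>j\<in>cluster l. x j))"
      unfolding sum_cluster_matrix sum_clusters[symmetric] by (intro sum.cong refl) auto
    also have "\<dots> = (\<Sum>l<r. (\<Sum>i\<in>cluster l. x i)\<^sup>2)"
      by (simp add: power2_eq_square sum_distrib_right)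
    finally show "0 \<le> quad_form {..<n} (cluster_matrix \<sigma>) x" by (simp add: sum_nonneg)
  qed (simp add: cluster_matrix_def)
  moreover have "(\<Sum>j<n. cluster_matrix \<sigma> i j) = real K" if "i < n" for i
    using sum_cluster_matrix[of "\<lambda>_. 1" i] card_cluster[OF label_less[OF that]] by simp
  ultimately show ?thesis by (simp add: sdp_feasible_def cluster_matrix_def)
qed

lemma sum_blockwise:
  "(\<Sum>j<n. h (\<sigma> j) * w j) = (\<Sum>l<r. h l * (\<Sum>j\<in>cluster l. w j :: real))"
  unfolding sum_clusters[symmetric] sum_distrib_left by (intro sum.cong refl) auto

lemma sum_blockwise_centred: "cluster_centred w \<Longrightarrow> (\<Sum>j<n. h (\<sigma> j) * w j) = 0"
  by (simp add: sum_blockwise cluster_centred_def)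

lemma quad_form_column_blockwise:
  assumes "cluster_centred w"
  shows "quad_form {..<n} (\<lambda>i j. f i (\<sigma> j)) w = 0"
proof -
  have "quad_form {..<n} (\<lambda>i j. f i (\<sigma> j)) w = (\<Sum>i<n. w i * (\<Sum>j<n. f i (\<sigma> j) * w j))"
    by (simp add: quad_form_def sum_distrib_left mult.assoc)
  then show ?thesis using sum_blockwise_centred[OF assms] by simp
qed

lemma quad_form_row_blockwise:
  "cluster_centred w \<Longrightarrow> quad_form {..<n} (\<lambda>i j. f j (\<sigma> i)) w = 0"
  using quad_form_column_blockwise[of w f] quad_form_transpose[of "{..<n}" "\<lambda>i j. f i (\<sigma> j)" w] by simp

lemma cluster_centred_diff_mean: "cluster_centred (\<lambda>i. v i - cluster_mean v (\<sigma> i))"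
  unfolding cluster_centred_def
proof (intro allI impI)
  fix l assume "l < r"
  have "(\<Sum>j\<in>cluster l. cluster_mean v (\<sigma> j)) = (\<Sum>j\<in>cluster l. cluster_mean v l)"
    by (rule sum.cong) auto
  also have "\<dots> = (\<Sum>j\<in>cluster l. v j)"
    using card_cluster[OF \<open>l < r\<close>] by (cases "K = 0") (auto simp: cluster_mean_def)
  finally show "(\<Sum>j\<in>cluster l. v j - cluster_mean v (\<sigma> j)) = 0" by (simp add: sum_subtractf)
qed

lemma sum_squares_diff_mean:
  "(\<Sum>i<n. (v i - cluster_mean v (\<sigma> i))\<^sup>2) = (\<Sum>i<n. (v i)\<^sup>2) - quad_form {..<n} (cluster_matrix \<sigma>) v / K"
proof -
  have "quad_form {..<n} (cluster_matrix \<sigma>) v / K = (\<Sum>i<n. v i * ((\<Sum>j<n. v j * cluster_matrix \<sigma> i j) / K))"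
    by (simp add: quad_form_def sum_distrib_left sum_divide_distrib mult_ac)
  also have "\<dots> = (\<Sum>i<n. v i * cluster_mean v (\<sigma> i))"
    by (simp add: sum_cluster_matrix cluster_mean_def)
  finally have "(\<Sum>i<n. (v i)\<^sup>2) - quad_form {..<n} (cluster_matrix \<sigma>) v / K
      = (\<Sum>i<n. (v i)\<^sup>2 - v i * cluster_mean v (\<sigma> i))"
    by (simp add: sum_subtractf)
  also have "\<dots> = (\<Sum>i<n. (v i - cluster_mean v (\<sigma> i))\<^sup>2)
      + (\<Sum>i<n. cluster_mean v (\<sigma> i) * (v i - cluster_mean v (\<sigma> i)))"
    unfolding sum.distrib[symmetric] by (intro sum.cong) (auto simp: power2_eq_square algebra_simps)
  also have "(\<Sum>i<n. cluster_mean v (\<sigma> i) * (v i - cluster_mean v (\<sigma> i))) = 0"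
    using cluster_centred_diff_mean by (rule sum_blockwise_centred)
  finally show ?thesis by simp
qed

lemma quad_form_diff_blockwise:
  assumes sym: "\<And>i j. i < n \<Longrightarrow> j < n \<Longrightarrow> S i j = S j i"
    and ker: "\<And>i l. i < n \<Longrightarrow> l < r \<Longrightarrow> (\<Sum>j\<in>cluster l. S i j) = 0"
  shows "quad_form {..<n} S (\<lambda>i. v i - h (\<sigma> i)) = quad_form {..<n} S v"
proof -
  have blockwise: "(\<Sum>j<n. h (\<sigma> j) * S i j) = 0" if "i < n" for i
    using that by (simp add: sum_blockwise ker)
  have "quad_form {..<n} S (\<lambda>i. v i - h (\<sigma> i))
      = (\<Sum>i<n. (v i - h (\<sigma> i)) * ((\<Sum>j<n. S i j * v j) - (\<Sum>j<n. h (\<sigma> j) * S i j)))"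
    unfolding quad_form_def sum_subtractf[symmetric] sum_distrib_left
    by (intro sum.cong refl) (simp add: algebra_simps)
  also have "\<dots> = (\<Sum>i<n. (v i - h (\<sigma> i)) * (\<Sum>j<n. S i j * v j))"
    by (simp add: blockwise)
  also have "\<dots> = quad_form {..<n} S v - (\<Sum>i<n. \<Sum>j<n. h (\<sigma> i) * (S i j * v j))"
    unfolding quad_form_def left_diff_distrib sum_subtractf sum_distrib_left by (simp add: mult_ac)
  also have "(\<Sum>i<n. \<Sum>j<n. h (\<sigma> i) * (S i j * v j)) = (\<Sum>j<n. v j * (\<Sum>i<n. h (\<sigma> i) * S j i))"
    unfolding sum_distrib_left by (subst sum.swap) (intro sum.cong refl, simp add: sym mult_ac)
  also have "\<dots> = 0" by (simp add: blockwise)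
  finally show ?thesis by simp
qed

lemma coercive_imp_mat_inner_ge:
  assumes sym: "\<And>i j. i < n \<Longrightarrow> j < n \<Longrightarrow> S i j = S j i"
    and ker: "\<And>i l. i < n \<Longrightarrow> l < r \<Longrightarrow> (\<Sum>j\<in>cluster l. S i j) = 0"
    and coercive: "\<And>w. cluster_centred w \<Longrightarrow> \<mu> * (\<Sum>i<n. (w i)\<^sup>2) \<le> quad_form {..<n} S w"
    and Z: "sdp_feasible n K Z"
  shows "\<mu> * (n - mat_inner n (cluster_matrix \<sigma>) Z / K) \<le> mat_inner n S Z"
proof -
  define P where "P i j = (if i = j then 1 else 0) - 1 / K * cluster_matrix \<sigma> i j" for i j
  have "psd n (\<lambda>i j. S i j - \<mu> * P i j)"
  proof (rule psdI)
    show "S i j - \<mu> * P i j = S j i - \<mu> * P j i" if "i < n" "j < n" for i j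
      using sym[OF that] by (simp add: P_def cluster_matrix_def)
    fix v
    have "quad_form {..<n} P v = (\<Sum>i<n. (v i - cluster_mean v (\<sigma> i))\<^sup>2)"
      unfolding P_def quad_form_diff quad_form_scale quad_form_diag[OF finite_lessThan] sum_squares_diff_mean
      by simp
    then show "0 \<le> quad_form {..<n} (\<lambda>i j. S i j - \<mu> * P i j) v"
      using coercive[OF cluster_centred_diff_mean] quad_form_diff_blockwise[OF sym ker]
      by (simp add: quad_form_diff quad_form_scale)
  qed
  then have "0 \<le> mat_inner n (\<lambda>i j. S i j - \<mu> * P i j) Z"
    using Z by (intro psd_imp_mat_inner_nonneg) (auto simp: sdp_feasible_def)
  also have "\<dots> = mat_inner n S Z - \<mu> * mat_inner n P Z"
    by (simp add: mat_inner_def left_diff_distrib sum_subtractf sum_distrib_left mult.assoc)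
  also have "mat_inner n P Z = (\<Sum>i<n. \<Sum>j<n. if i = j then Z i j else 0) - mat_inner n (cluster_matrix \<sigma>) Z / K"
    unfolding mat_inner_def sum_divide_distrib sum_subtractf[symmetric]
    by (intro sum.cong refl) (auto simp: P_def left_diff_distrib)
  also have "(\<Sum>i<n. \<Sum>j<n. if i = j then Z i j else 0) = n"
    using Z by (simp add: sdp_feasible_def)
  finally show ?thesis by simp
qed

lemma sum_squares_diff_cluster_matrix_le:
  assumes Z: "sdp_feasible n K Z"
  shows "(\<Sum>i<n. \<Sum>j<n. (Z i j - cluster_matrix \<sigma> i j)\<^sup>2) \<le> 2 * (real n * K - mat_inner n (cluster_matrix \<sigma>) Z)"
proof -
  have "(Z i j - cluster_matrix \<sigma> i j)\<^sup>2 \<le> Z i j + cluster_matrix \<sigma> i j - 2 * (cluster_matrix \<sigma> i j * Z i j)"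
    if "i < n" "j < n" for i j
  proof -
    have "Z i j * Z i j \<le> Z i j * 1"
      using Z that sdp_feasible_entry_le_1[OF Z] by (intro mult_left_mono) (auto simp: sdp_feasible_def)
    moreover have "(cluster_matrix \<sigma> i j)\<^sup>2 = cluster_matrix \<sigma> i j"
      by (simp add: cluster_matrix_def)
    ultimately show ?thesis by (simp add: power2_diff power2_eq_square[of "Z i j"] mult_ac)
  qed
  then have "(\<Sum>i<n. \<Sum>j<n. (Z i j - cluster_matrix \<sigma> i j)\<^sup>2)
      \<le> (\<Sum>i<n. \<Sum>j<n. Z i j + cluster_matrix \<sigma> i j - 2 * (cluster_matrix \<sigma> i j * Z i j))"
    by (intro sum_mono) auto
  also have "\<dots> = (\<Sum>i<n. \<Sum>j<n. Z i j) + (\<Sum>i<n. \<Sum>j<n. cluster_matrix \<sigma> i j)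
      - 2 * mat_inner n (cluster_matrix \<sigma>) Z"
    by (simp add: mat_inner_def sum.distrib sum_subtractf sum_distrib_left)
  also have "\<dots> = 2 * (real n * K - mat_inner n (cluster_matrix \<sigma>) Z)"
    using Z cluster_matrix_feasible by (simp add: sdp_feasible_def)
  finally show ?thesis .
qed

text \<open>In the Lagrangian dual, \<open>d\<close>, \<open>lam\<close>, \<open>B\<close> and \<open>S\<close> are the multipliers of the diagonal, row sum,
  nonnegativity and positive semidefiniteness constraints.\<close>

lemma certificate_imp_sdp_unique_opt:
  assumes A: "\<And>i j. i < n \<Longrightarrow> j < n \<Longrightarrow>
      A i j = (if i = j then d i else 0) + lam i + lam j - B i j - S i j"
    and S_sym: "\<And>i j. i < n \<Longrightarrow> j < n \<Longrightarrow> S i j = S j i"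
    and S_ker: "\<And>i l. i < n \<Longrightarrow> l < r \<Longrightarrow> (\<Sum>j\<in>cluster l. S i j) = 0"
    and S_coercive: "\<And>w. cluster_centred w \<Longrightarrow> \<mu> * (\<Sum>i<n. (w i)\<^sup>2) \<le> quad_form {..<n} S w"
    and \<mu>: "\<mu> > 0"
    and B_nonneg: "\<And>i j. i < n \<Longrightarrow> j < n \<Longrightarrow> B i j \<ge> 0"
    and B_zero: "\<And>i j. i < n \<Longrightarrow> j < n \<Longrightarrow> \<sigma> i = \<sigma> j \<Longrightarrow> B i j = 0"
  shows "sdp_unique_opt n K A (cluster_matrix \<sigma>)"
  unfolding sdp_unique_opt_def
proof (intro conjI allI impI cluster_matrix_feasible)
  fix Z assume "sdp_feasible n K Z \<and> (\<exists>i<n. \<exists>j<n. Z i j \<noteq> cluster_matrix \<sigma> i j)"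
  then obtain i j where Z: "sdp_feasible n K Z" and ij: "i < n" "j < n" "Z i j \<noteq> cluster_matrix \<sigma> i j" by blast
  have K: "real K > 0" using ij(1) n_eq by (auto intro: gr0I)
  have "0 < (Z i j - cluster_matrix \<sigma> i j)\<^sup>2" using ij(3) by simp
  also have "\<dots> \<le> (\<Sum>j<n. (Z i j - cluster_matrix \<sigma> i j)\<^sup>2)"
    using ij(2) by (intro member_le_sum) auto
  also have "\<dots> \<le> (\<Sum>i<n. \<Sum>j<n. (Z i j - cluster_matrix \<sigma> i j)\<^sup>2)"
    using ij(1) by (intro member_le_sum) (auto intro: sum_nonneg)
  also note sum_squares_diff_cluster_matrix_le[OF Z]
  finally have "0 < real n * K - mat_inner n (cluster_matrix \<sigma>) Z" by simp
  then have "0 < \<mu> * (n - mat_inner n (cluster_matrix \<sigma>) Z / K)"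
    using \<mu> K by (intro mult_pos_pos) (auto simp: field_simps)
  then have SZ: "0 < mat_inner n S Z"
    using coercive_imp_mat_inner_ge[OF S_sym S_ker S_coercive Z] by linarith
  have BZ: "0 \<le> mat_inner n B Z"
    unfolding mat_inner_def using B_nonneg Z by (intro sum_nonneg mult_nonneg_nonneg) (auto simp: sdp_feasible_def)
  have "mat_inner n B (cluster_matrix \<sigma>) = 0" "mat_inner n S (cluster_matrix \<sigma>) = 0"
    using B_zero S_ker label_less by (simp_all add: mat_inner_def sum_cluster_matrix)
  then show "mat_inner n A Z < mat_inner n A (cluster_matrix \<sigma>)"
    using mat_inner_eq_dual_value[OF Z A] mat_inner_eq_dual_value[OF cluster_matrix_feasible A] SZ BZ by simp
qed

end

definition mean_matrix :: "real \<Rightarrow> real \<Rightarrow> (nat \<Rightarrow> nat) \<Rightarrow> nat \<Rightarrow> nat \<Rightarrow> real" where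
  "mean_matrix p q \<sigma> i j = (if i = j then 0 else if \<sigma> i = \<sigma> j then p else q)"

text \<open>The row multiplier of \<open>i\<close> is essentially the largest number of edges from \<open>i\<close> to a foreign cluster,
  divided by \<open>K\<close>. The block of entry multipliers between two clusters is a row term plus a column term,
  determined by the kernel condition on the slack; hence their quadratic form vanishes on cluster centred
  vectors, where only the diagonal multipliers compete with the centred adjacency matrix. The shift
  \<open>(q - \<beta> / K) / 2\<close> is the largest for which the discrepancy bound keeps the entry multipliers nonnegative.\<close>

locale regular_clustering = balanced_clustering +
  fixes A :: "nat \<Rightarrow> nat \<Rightarrow> real" and p q \<beta> \<gamma> g :: real
  assumes two_clusters: "r \<ge> 2" and cluster_size_pos: "K > 0"
    and within_mean_nonneg: "p \<ge> 0" and discrepancy_const_nonneg: "\<beta> \<ge> 0"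
    and symmetric: "\<And>i j. A i j = A j i"
    and discrepancy: "discrepancy_le {..<n} (\<lambda>i j. A i j - mean_matrix p q \<sigma> i j) \<beta>"
    and centred_quad_form_le:
      "\<And>x. quad_form {..<n} (\<lambda>i j. A i j - mean_matrix p q \<sigma> i j) x \<le> \<gamma> * (\<Sum>i<n. (x i)\<^sup>2)"
    and gap: "cluster_gap A g"
    and gap_dominates: "\<gamma> + (r + 1) * \<beta> < g"
begin

definition max_foreign_degree :: "nat \<Rightarrow> real" where
  "max_foreign_degree i = Max (cluster_degree A i ` ({..<r} - {\<sigma> i}))"

definition row_multiplier :: "nat \<Rightarrow> real" where
  "row_multiplier i = max_foreign_degree i / K - (q - \<beta> / K) / 2"

definition row_term :: "nat \<Rightarrow> nat \<Rightarrow> real" where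
  "row_term i l = row_multiplier i - cluster_degree A i l / K
     + block_sum A (cluster (\<sigma> i)) (cluster l) / (2 * real K ^ 2)"

definition entry_multiplier :: "nat \<Rightarrow> nat \<Rightarrow> real" where
  "entry_multiplier i j = (if \<sigma> i = \<sigma> j then 0 else row_term i (\<sigma> j) + row_term j (\<sigma> i))"

definition diag_multiplier :: "nat \<Rightarrow> real" where
  "diag_multiplier i = cluster_degree A i (\<sigma> i) - K * row_multiplier i
     - (\<Sum>j\<in>cluster (\<sigma> i). row_multiplier j)"

definition slack :: "nat \<Rightarrow> nat \<Rightarrow> real" where
  "slack i j = (if i = j then diag_multiplier i else 0) + row_multiplier i + row_multiplier j
     - entry_multiplier i j - A i j"

lemma cluster_degree_le_max: "l < r \<Longrightarrow> l \<noteq> \<sigma> i \<Longrightarrow> cluster_degree A i l \<le> max_foreign_degree i"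
  unfolding max_foreign_degree_def by (intro Max_ge) auto

lemma max_foreign_degree_attained: "\<exists>l<r. l \<noteq> \<sigma> i \<and> max_foreign_degree i = cluster_degree A i l"
proof -
  have "(if \<sigma> i = 0 then 1 else 0) \<in> {..<r} - {\<sigma> i}" using two_clusters by auto
  then have "cluster_degree A i ` ({..<r} - {\<sigma> i}) \<noteq> {}" by blast
  then have "max_foreign_degree i \<in> cluster_degree A i ` ({..<r} - {\<sigma> i})"
    unfolding max_foreign_degree_def by (intro Max_in) auto
  then show ?thesis by auto
qed

lemma block_sum_symmetric: "block_sum A T S = block_sum A S T"
  using block_sum_transpose[of A S T] by (simp flip: symmetric)

lemma sum_foreign_degree_discrepancy:
  assumes S: "S \<subseteq> cluster k" and kl: "k \<noteq> l" "k < r" "l < r"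
  shows "\<bar>\<Sum>i\<in>S. cluster_degree A i l - K * q\<bar> \<le> \<beta> * K"
proof -
  have "(\<Sum>i\<in>S. cluster_degree A i l - K * q) = block_sum (\<lambda>i j. A i j - mean_matrix p q \<sigma> i j) S (cluster l)"
    unfolding block_sum_def
  proof (rule sum.cong)
    fix i assume "i \<in> S"
    then have "(\<Sum>j\<in>cluster l. mean_matrix p q \<sigma> i j) = (\<Sum>j\<in>cluster l. q)"
      using S kl by (intro sum.cong) (auto simp: mean_matrix_def)
    then show "cluster_degree A i l - K * q = (\<Sum>j\<in>cluster l. A i j - mean_matrix p q \<sigma> i j)"
      using card_cluster[OF kl(3)] by (simp add: cluster_degree_def sum_subtractf)
  qed simp
  also have "\<bar>\<dots>\<bar> \<le> \<beta> * sqrt (real (card S) * real (card (cluster l)))"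
    using S cluster_subset by (intro discrepancy_leD[OF discrepancy]) blast+
  also have "\<dots> \<le> \<beta> * sqrt (real K * real K)"
    using card_cluster kl card_mono[OF finite_cluster S] discrepancy_const_nonneg
    by (intro mult_left_mono real_sqrt_le_mono mult_mono) auto
  finally show ?thesis by simp
qed

lemma foreign_block_sum_ge:
  assumes "k \<noteq> l" "k < r" "l < r"
  shows "real K ^ 2 * q - \<beta> * K \<le> block_sum A (cluster k) (cluster l)"
  using sum_foreign_degree_discrepancy[OF order.refl assms] card_cluster[OF assms(2)]
  by (simp add: block_sum_def cluster_degree_def sum_subtractf power2_eq_square)

lemma entry_multiplier_nonneg:
  assumes "i < n" "j < n"
  shows "0 \<le> entry_multiplier i j"
proof (cases "\<sigma> i = \<sigma> j")
  case False
  define E where "E = block_sum A (cluster (\<sigma> i)) (cluster (\<sigma> j))"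
  have "entry_multiplier i j = (max_foreign_degree i - cluster_degree A i (\<sigma> j)) / K
      + (max_foreign_degree j - cluster_degree A j (\<sigma> i)) / K + (E / real K ^ 2 - (q - \<beta> / K))"
    using False block_sum_symmetric[of "cluster (\<sigma> i)" "cluster (\<sigma> j)"]
    by (simp add: entry_multiplier_def row_term_def row_multiplier_def E_def diff_divide_distrib)
  moreover have "(real K ^ 2 * q - \<beta> * K) / real K ^ 2 \<le> E / real K ^ 2"
    unfolding E_def using foreign_block_sum_ge[OF False] label_less assms by (intro divide_right_mono) auto
  moreover have "(real K ^ 2 * q - \<beta> * K) / real K ^ 2 = q - \<beta> / K"
    using cluster_size_pos by (simp add: field_simps power2_eq_square)
  moreover have "(max_foreign_degree i - cluster_degree A i (\<sigma> j)) / K \<ge> 0"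
    "(max_foreign_degree j - cluster_degree A j (\<sigma> i)) / K \<ge> 0"
    using cluster_degree_le_max[of "\<sigma> j" i] cluster_degree_le_max[of "\<sigma> i" j] False label_less assms by auto
  ultimately show ?thesis by linarith
qed (simp add: entry_multiplier_def)

lemma max_foreign_degree_le_sum:
  assumes "i \<in> cluster k"
  shows "max_foreign_degree i - K * q \<le> (\<Sum>l\<in>{..<r} - {k}. max 0 (cluster_degree A i l - K * q))"
proof -
  obtain l where l: "l < r" "l \<noteq> \<sigma> i" "max_foreign_degree i = cluster_degree A i l"
    using max_foreign_degree_attained by blast
  then have "max_foreign_degree i - K * q \<le> max 0 (cluster_degree A i l - K * q)" by simp
  also have "\<dots> \<le> (\<Sum>l\<in>{..<r} - {k}. max 0 (cluster_degree A i l - K * q))"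
    using l assms by (intro member_le_sum) auto
  finally show ?thesis .
qed

lemma sum_max_foreign_degree_le:
  assumes k: "k < r"
  shows "(\<Sum>i\<in>cluster k. max_foreign_degree i) \<le> real K * (K * q + r * \<beta>)"
proof -
  define rich where "rich l = {i \<in> cluster k. 0 \<le> cluster_degree A i l - K * q}" for l
  have "(\<Sum>i\<in>cluster k. max_foreign_degree i - K * q)
      \<le> (\<Sum>i\<in>cluster k. \<Sum>l\<in>{..<r} - {k}. max 0 (cluster_degree A i l - K * q))"
    by (intro sum_mono max_foreign_degree_le_sum)
  also have "\<dots> = (\<Sum>l\<in>{..<r} - {k}. \<Sum>i\<in>cluster k. max 0 (cluster_degree A i l - K * q))"
    by (rule sum.swap)
  also have "\<dots> = (\<Sum>l\<in>{..<r} - {k}. \<Sum>i\<in>rich l. cluster_degree A i l - K * q)"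
    unfolding rich_def sum.inter_filter[OF finite_cluster] by (intro sum.cong) auto
  also have "\<dots> \<le> (\<Sum>l\<in>{..<r} - {k}. \<beta> * K)"
  proof (rule sum_mono)
    fix l assume "l \<in> {..<r} - {k}"
    then have "\<bar>\<Sum>i\<in>rich l. cluster_degree A i l - K * q\<bar> \<le> \<beta> * K"
      using k by (intro sum_foreign_degree_discrepancy[of _ k]) (auto simp: rich_def)
    then show "(\<Sum>i\<in>rich l. cluster_degree A i l - K * q) \<le> \<beta> * K" by linarith
  qed
  also have "\<dots> \<le> r * (\<beta> * K)"
    using discrepancy_const_nonneg k by (auto intro!: mult_right_mono)
  finally show ?thesis using card_cluster[OF k] by (simp add: sum_subtractf algebra_simps)
qed

lemma diag_multiplier_ge:
  assumes i: "i < n"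
  shows "g - (r + 1) * \<beta> \<le> diag_multiplier i"
proof -
  have "(\<Sum>j\<in>cluster (\<sigma> i). row_multiplier j)
      = (\<Sum>j\<in>cluster (\<sigma> i). max_foreign_degree j) / K - (K * q - \<beta>) / 2"
    unfolding row_multiplier_def sum_subtractf sum_divide_distrib[symmetric]
    using cluster_size_pos card_cluster[OF label_less[OF i]] by (simp add: field_simps)
  moreover have "K * row_multiplier i = max_foreign_degree i - (K * q - \<beta>) / 2"
    using cluster_size_pos by (simp add: row_multiplier_def field_simps)
  ultimately have "diag_multiplier i = cluster_degree A i (\<sigma> i) - max_foreign_degree i
      - (\<Sum>j\<in>cluster (\<sigma> i). max_foreign_degree j) / K + (K * q - \<beta>)"
    by (simp add: diag_multiplier_def field_simps)
  moreover have "(\<Sum>j\<in>cluster (\<sigma> i). max_foreign_degree j) / K \<le> K * q + r * \<beta>"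
    using sum_max_foreign_degree_le[OF label_less[OF i]] cluster_size_pos by (simp add: field_simps)
  moreover have "max_foreign_degree i + g \<le> cluster_degree A i (\<sigma> i)"
    using max_foreign_degree_attained[of i] gap i by (auto simp: cluster_gap_def)
  ultimately show ?thesis by (simp add: algebra_simps)
qed

lemma sum_entry_multiplier_foreign:
  assumes l: "l < r" "l \<noteq> \<sigma> i"
  shows "(\<Sum>j\<in>cluster l. entry_multiplier i j)
    = K * row_multiplier i + (\<Sum>j\<in>cluster l. row_multiplier j) - cluster_degree A i l"
proof -
  define E where "E = block_sum A (cluster l) (cluster (\<sigma> i))"
  have E: "(\<Sum>j\<in>cluster l. cluster_degree A j (\<sigma> i)) = E"
    by (simp add: E_def block_sum_def cluster_degree_def)
  have "(\<Sum>j\<in>cluster l. entry_multiplier i j) = (\<Sum>j\<in>cluster l. row_term i l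
      + (row_multiplier j - cluster_degree A j (\<sigma> i) / K + E / (2 * real K ^ 2)))"
    using l(2) by (intro sum.cong) (auto simp: entry_multiplier_def row_term_def E_def)
  also have "\<dots> = K * row_term i l + (\<Sum>j\<in>cluster l. row_multiplier j) - E / K + K * (E / (2 * real K ^ 2))"
    using card_cluster[OF l(1)]
    by (simp add: sum.distrib sum_subtractf E sum_divide_distrib[symmetric])
  also have "\<dots> = K * row_multiplier i + (\<Sum>j\<in>cluster l. row_multiplier j) - cluster_degree A i l"
    using cluster_size_pos block_sum_symmetric[of "cluster (\<sigma> i)" "cluster l"]
    by (simp add: row_term_def E_def field_simps power2_eq_square)
  finally show ?thesis .
qed

lemma sum_slack_cluster:
  assumes i: "i < n" and l: "l < r"
  shows "(\<Sum>j\<in>cluster l. slack i j) = 0"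
proof -
  have "(\<Sum>j\<in>cluster l. slack i j) = (\<Sum>j\<in>cluster l. if i = j then diag_multiplier i else 0)
      + K * row_multiplier i + (\<Sum>j\<in>cluster l. row_multiplier j)
      - (\<Sum>j\<in>cluster l. entry_multiplier i j) - cluster_degree A i l"
    using card_cluster[OF l] by (simp add: slack_def sum.distrib sum_subtractf cluster_degree_def)
  also have "\<dots> = 0"
  proof (cases "l = \<sigma> i")
    case True
    moreover have "(\<Sum>j\<in>cluster (\<sigma> i). entry_multiplier i j) = 0"
      by (intro sum.neutral) (simp add: entry_multiplier_def)
    ultimately show ?thesis using i by (simp add: diag_multiplier_def)
  next
    case False
    then have "(\<Sum>j\<in>cluster l. if i = j then diag_multiplier i else 0) = 0" by simp
    then show ?thesis using sum_entry_multiplier_foreign[OF l False] by simp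
  qed
  finally show ?thesis .
qed

lemma quad_form_entry_multiplier:
  assumes "cluster_centred w"
  shows "quad_form {..<n} entry_multiplier w = 0"
proof -
  define f where "f i l = (if \<sigma> i = l then 0 else row_term i l)" for i l
  have "entry_multiplier = (\<lambda>i j. f i (\<sigma> j) + f j (\<sigma> i))"
    by (intro ext) (auto simp: entry_multiplier_def f_def)
  then show ?thesis
    using quad_form_column_blockwise[OF assms] quad_form_row_blockwise[OF assms] by (simp add: quad_form_add)
qed

lemma quad_form_mean_matrix_nonpos:
  assumes "cluster_centred w"
  shows "quad_form {..<n} (mean_matrix p q \<sigma>) w \<le> 0"
proof -
  have "mean_matrix p q \<sigma> = (\<lambda>i j. (if \<sigma> i = \<sigma> j then p else q) - (if i = j then p else 0))"
    by (intro ext) (auto simp: mean_matrix_def)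
  then have "quad_form {..<n} (mean_matrix p q \<sigma>) w = - (\<Sum>i<n. p * (w i)\<^sup>2)"
    using quad_form_column_blockwise[OF assms, of "\<lambda>i l. if \<sigma> i = l then p else q"]
    by (simp add: quad_form_diff quad_form_diag)
  then show ?thesis using within_mean_nonneg by (simp add: sum_nonneg)
qed

lemma slack_coercive:
  assumes w: "cluster_centred w"
  shows "(g - (r + 1) * \<beta> - \<gamma>) * (\<Sum>i<n. (w i)\<^sup>2) \<le> quad_form {..<n} slack w"
proof -
  have "slack = (\<lambda>i j. (if i = j then diag_multiplier i else 0) + row_multiplier i + row_multiplier j
      - entry_multiplier i j - (A i j - mean_matrix p q \<sigma> i j) - mean_matrix p q \<sigma> i j)"
    by (intro ext) (simp add: slack_def)
  then have "quad_form {..<n} slack w = (\<Sum>i<n. diag_multiplier i * (w i)\<^sup>2)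
      - quad_form {..<n} (\<lambda>i j. A i j - mean_matrix p q \<sigma> i j) w - quad_form {..<n} (mean_matrix p q \<sigma>) w"
    using quad_form_column_blockwise[OF w, of "\<lambda>i _. row_multiplier i"]
      quad_form_row_blockwise[OF w, of "\<lambda>j _. row_multiplier j"] quad_form_entry_multiplier[OF w]
    by (simp only: quad_form_add quad_form_diff quad_form_diag[OF finite_lessThan])
  moreover have "(\<Sum>i<n. (g - (r + 1) * \<beta>) * (w i)\<^sup>2) \<le> (\<Sum>i<n. diag_multiplier i * (w i)\<^sup>2)"
    using diag_multiplier_ge by (intro sum_mono mult_right_mono) auto
  ultimately show ?thesis
    using centred_quad_form_le[of w] quad_form_mean_matrix_nonpos[OF w]
    unfolding sum_distrib_left[symmetric] left_diff_distrib[of _ \<gamma>] by linarith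
qed

lemma sdp_unique_opt: "sdp_unique_opt n K A (cluster_matrix \<sigma>)"
proof (rule certificate_imp_sdp_unique_opt[where S = slack and B = entry_multiplier])
  show "A i j = (if i = j then diag_multiplier i else 0) + row_multiplier i + row_multiplier j
      - entry_multiplier i j - slack i j" for i j
    by (simp add: slack_def)
  show "slack i j = slack j i" for i j
    using symmetric[of i j] by (simp add: slack_def entry_multiplier_def)
  show "0 < g - (r + 1) * \<beta> - \<gamma>" using gap_dominates by simp
  show "entry_multiplier i j = 0" if "\<sigma> i = \<sigma> j" for i j using that by (simp add: entry_multiplier_def)
qed (fact sum_slack_cluster slack_coercive entry_multiplier_nonneg)+

end

section \<open>Random graphs with independent edges\<close>

lemma expectation_exp_bernoulli_le:
  assumes "0 \<le> p" "p \<le> 1"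
  shows "measure_pmf.expectation (bernoulli_pmf p) (\<lambda>x. exp (if x then c else 0)) \<le> exp (p * (exp c - 1))"
proof -
  have "measure_pmf.expectation (bernoulli_pmf p) (\<lambda>x. exp (if x then c else 0)) = 1 + p * (exp c - 1)"
    using assms by (simp add: algebra_simps)
  also have "\<dots> \<le> exp (p * (exp c - 1))" by (rule exp_ge_add_one_self)
  finally show ?thesis .
qed

lemma prob_Pi_bernoulli_weighted_sum_ge_le:
  assumes E: "finite E" and P: "\<And>e. e \<in> E \<Longrightarrow> 0 \<le> P e \<and> P e \<le> 1"
  shows "measure_pmf.prob (Pi_pmf E False (\<lambda>e. bernoulli_pmf (P e))) {G. t \<le> (\<Sum>e\<in>E. if G e then c e else 0)}
     \<le> exp ((\<Sum>e\<in>E. P e * (exp (c e) - 1)) - t)"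
proof -
  define M where "M = Pi_pmf E False (\<lambda>e. bernoulli_pmf (P e))"
  define u where "u G = (\<Prod>e\<in>E. exp (if G e then c e else 0))" for G
  have "set_pmf M \<subseteq> PiE_dflt E False (set_pmf \<circ> (\<lambda>e. bernoulli_pmf (P e)))"
    unfolding M_def by (rule set_Pi_pmf_subset'[OF E])
  then have finite_support: "finite (set_pmf M)"
    by (rule finite_subset) (use E in \<open>auto intro!: finite_PiE_dflt\<close>)
  have "{G. t \<le> (\<Sum>e\<in>E. if G e then c e else 0)} = {G \<in> space (measure_pmf M). exp t \<le> u G}"
    using E by (auto simp: u_def exp_sum[symmetric])
  then have "measure_pmf.prob M {G. t \<le> (\<Sum>e\<in>E. if G e then c e else 0)}
      = measure_pmf.prob M {G \<in> space (measure_pmf M). exp t \<le> u G}" by simp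
  also have "\<dots> \<le> measure_pmf.expectation M u / exp t"
    by (rule integral_Markov_inequality_measure[where A = "{}"])
      (auto simp: u_def intro!: integrable_measure_pmf_finite finite_support prod_nonneg)
  also have "measure_pmf.expectation M u
      = (\<Prod>e\<in>E. measure_pmf.expectation (bernoulli_pmf (P e)) (\<lambda>x. exp (if x then c e else 0)))"
    unfolding u_def M_def
    by (rule expectation_prod_Pi_pmf) (auto intro!: integrable_measure_pmf_finite E)
  also have "\<dots> \<le> (\<Prod>e\<in>E. exp (P e * (exp (c e) - 1)))"
    using P by (intro prod_mono conjI expectation_exp_bernoulli_le integral_nonneg_AE) auto
  also have "\<dots> = exp (\<Sum>e\<in>E. P e * (exp (c e) - 1))" using E by (simp add: exp_sum)
  finally show ?thesis by (simp add: M_def exp_diff divide_right_mono)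
qed

lemma finite_vpairs [simp]: "finite (vpairs n)"
  by (rule finite_subset[of _ "{..<n} \<times> {..<n}"]) (auto simp: vpairs_def)

lemma sum_vpairs:
  fixes g :: "nat \<Rightarrow> nat \<Rightarrow> 'a :: comm_monoid_add"
  shows "(\<Sum>i<n. \<Sum>j<n. g i j) = (\<Sum>(i, j)\<in>vpairs n. g i j + g j i) + (\<Sum>i<n. g i i)"
proof (induction n)
  case 0
  then show ?case by (simp add: vpairs_def)
next
  case (Suc n)
  have split: "vpairs (Suc n) = vpairs n \<union> (\<lambda>i. (i, n)) ` {..<n}"
    by (auto simp: vpairs_def less_Suc_eq)
  have "(\<Sum>(i, j)\<in>vpairs (Suc n). g i j + g j i)
      = (\<Sum>(i, j)\<in>vpairs n. g i j + g j i) + (\<Sum>(i, j)\<in>(\<lambda>i. (i, n)) ` {..<n}. g i j + g j i)"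
    unfolding split by (rule sum.union_disjoint) (simp_all, auto simp: vpairs_def)
  also have "(\<Sum>(i, j)\<in>(\<lambda>i. (i, n)) ` {..<n}. g i j + g j i) = (\<Sum>i<n. g i n + g n i)"
    by (subst sum.reindex) (auto simp: inj_on_def)
  finally show ?case using Suc.IH by (simp add: sum.distrib ac_simps)
qed

lemma adj_matrix_sym: "adj_matrix G i j = adj_matrix G j i"
  by (auto simp: adj_matrix_def)

definition random_graph :: "nat \<Rightarrow> (nat \<Rightarrow> nat \<Rightarrow> real) \<Rightarrow> (nat \<times> nat \<Rightarrow> bool) pmf" where
  "random_graph n P = Pi_pmf (vpairs n) False (\<lambda>(i, j). bernoulli_pmf (P i j))"

lemma random_graph_support:
  "G \<in> set_pmf (random_graph n P) \<Longrightarrow> e \<notin> vpairs n \<Longrightarrow> \<not> G e"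
  using set_Pi_pmf_subset[OF finite_vpairs, of n False] unfolding random_graph_def by blast

lemma sum_adj_matrix_eq:
  fixes w :: "nat \<Rightarrow> nat \<Rightarrow> real"
  assumes G: "G \<in> set_pmf (random_graph n P)"
  shows "(\<Sum>i<n. \<Sum>j<n. w i j * adj_matrix G i j)
    = (\<Sum>e\<in>vpairs n. if G e then w (fst e) (snd e) + w (snd e) (fst e) else 0)"
proof -
  have "adj_matrix G i i = 0" for i
    using random_graph_support[OF G, of "(i, i)"] by (simp add: adj_matrix_def vpairs_def)
  then have "(\<Sum>i<n. \<Sum>j<n. w i j * adj_matrix G i j)
      = (\<Sum>(i, j)\<in>vpairs n. w i j * adj_matrix G i j + w j i * adj_matrix G j i)"
    unfolding sum_vpairs by simp
  also have "\<dots> = (\<Sum>e\<in>vpairs n. if G e then w (fst e) (snd e) + w (snd e) (fst e) else 0)"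
  proof (intro sum.cong refl, clarify)
    fix i j assume "(i, j) \<in> vpairs n"
    then have "\<not> G (j, i)" by (intro random_graph_support[OF G]) (auto simp: vpairs_def)
    then show "w i j * adj_matrix G i j + w j i * adj_matrix G j i
        = (if G (i, j) then w (fst (i, j)) (snd (i, j)) + w (snd (i, j)) (fst (i, j)) else 0)"
      by (simp add: adj_matrix_def)
  qed
  finally show ?thesis .
qed

locale edge_probabilities =
  fixes n :: nat and P :: "nat \<Rightarrow> nat \<Rightarrow> real" and p :: real
  assumes P_sym: "P i j = P j i" and P_diag: "P i i = 0"
    and P_nonneg: "0 \<le> P i j" and P_le: "P i j \<le> p" and p_le_1: "p \<le> 1"
begin

abbreviation graph_prob :: "(nat \<times> nat \<Rightarrow> bool) set \<Rightarrow> real" where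
  "graph_prob \<equiv> measure_pmf.prob (random_graph n P)"

abbreviation centred_adj :: "(nat \<times> nat \<Rightarrow> bool) \<Rightarrow> nat \<Rightarrow> nat \<Rightarrow> real" where
  "centred_adj G \<equiv> \<lambda>i j. adj_matrix G i j - P i j"

lemma p_nonneg: "0 \<le> p"
  using P_nonneg P_le by (rule order.trans)

lemma centred_adj_sym: "centred_adj G i j = centred_adj G j i"
  using P_sym[of i j] adj_matrix_sym[of G i j] by simp

lemma sum_vpairs_weighted:
  "(\<Sum>(i, j)\<in>vpairs n. P i j * (h i j + h j i)) = (\<Sum>i<n. \<Sum>j<n. P i j * h i j)"
proof -
  have "(\<Sum>(i, j)\<in>vpairs n. P i j * (h i j + h j i)) = (\<Sum>(i, j)\<in>vpairs n. P i j * h i j + P j i * h j i)"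
    by (intro sum.cong refl) (auto simp: P_sym distrib_left)
  then show ?thesis by (simp add: sum_vpairs P_diag)
qed

lemma weighted_edges_tail:
  "graph_prob {G. t \<le> (\<Sum>i<n. \<Sum>j<n. w i j * adj_matrix G i j)}
     \<le> exp ((\<Sum>(i, j)\<in>vpairs n. P i j * (exp (w i j + w j i) - 1)) - t)"
proof -
  define c where "c e = w (fst e) (snd e) + w (snd e) (fst e)" for e
  define Q where "Q e = P (fst e) (snd e)" for e
  have graph: "random_graph n P = Pi_pmf (vpairs n) False (\<lambda>e. bernoulli_pmf (Q e))"
    unfolding random_graph_def by (rule Pi_pmf_cong) (auto simp: Q_def)
  have "graph_prob {G. t \<le> (\<Sum>i<n. \<Sum>j<n. w i j * adj_matrix G i j)}
      \<le> graph_prob {G. t \<le> (\<Sum>e\<in>vpairs n. if G e then c e else 0)}"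
    unfolding c_def
    by (rule measure_pmf.finite_measure_mono_AE) (auto simp: AE_measure_pmf_iff sum_adj_matrix_eq)
  also have "\<dots> \<le> exp ((\<Sum>e\<in>vpairs n. Q e * (exp (c e) - 1)) - t)"
    unfolding graph using P_nonneg order.trans[OF P_le p_le_1]
    by (intro prob_Pi_bernoulli_weighted_sum_ge_le) (auto simp: Q_def)
  finally show ?thesis by (simp add: Q_def c_def case_prod_unfold)
qed

lemma weighted_degree_tail:
  assumes v: "v < n"
  shows "graph_prob {G. t \<le> (\<Sum>j<n. s j * adj_matrix G v j)} \<le> exp ((\<Sum>j<n. P v j * (exp (s j) - 1)) - t)"
proof -
  define w where "w i j = (if i = v then s j else 0)" for i j
  define h where "h i j = (if i = v then exp (s j) - 1 else 0)" for i j
  have row: "(\<Sum>i<n. \<Sum>j<n. if i = v then f i j else 0) = (\<Sum>j<n. f v j)" for f :: "nat \<Rightarrow> nat \<Rightarrow> real"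
  proof -
    have "(\<Sum>i<n. \<Sum>j<n. if i = v then f i j else 0) = (\<Sum>i<n. if i = v then \<Sum>j<n. f i j else 0)"
      by (intro sum.cong) auto
    then show ?thesis using v by simp
  qed
  have "(\<Sum>(i, j)\<in>vpairs n. P i j * (exp (w i j + w j i) - 1)) = (\<Sum>(i, j)\<in>vpairs n. P i j * (h i j + h j i))"
    by (intro sum.cong refl) (auto simp: w_def h_def vpairs_def)
  also have "\<dots> = (\<Sum>j<n. P v j * (exp (s j) - 1))"
    unfolding sum_vpairs_weighted row[of "\<lambda>i j. P i j * (exp (s j) - 1)", symmetric]
    by (intro sum.cong) (auto simp: h_def)
  finally have "(\<Sum>(i, j)\<in>vpairs n. P i j * (exp (w i j + w j i) - 1)) = (\<Sum>j<n. P v j * (exp (s j) - 1))" .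
  moreover have "(\<Sum>i<n. \<Sum>j<n. w i j * adj_matrix G i j) = (\<Sum>j<n. s j * adj_matrix G v j)" for G
    unfolding row[of "\<lambda>i j. s j * adj_matrix G i j", symmetric] by (intro sum.cong) (auto simp: w_def)
  ultimately show ?thesis using weighted_edges_tail[of t w] by simp
qed

lemma degree_tail:
  assumes v: "v < n"
  shows "graph_prob {G. t \<le> (\<Sum>j<n. adj_matrix G v j)} \<le> exp (2 * (n * p) - t)"
proof -
  have "graph_prob {G. t \<le> (\<Sum>j<n. adj_matrix G v j)} \<le> exp ((\<Sum>j<n. P v j * (exp 1 - 1)) - t)"
    using weighted_degree_tail[OF v, of t "\<lambda>_. 1"] by simp
  also have "(\<Sum>j<n. P v j * (exp 1 - 1)) \<le> (\<Sum>j<n. p * 2)"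
    using exp_le P_le P_nonneg p_nonneg by (intro sum_mono mult_mono) auto
  finally show ?thesis by (simp add: mult_ac)
qed

lemma degree_difference_tail:
  assumes v: "v < n" and S: "S \<subseteq> {..<n}" and T: "T \<subseteq> {..<n}" and disjoint: "S \<inter> T = {}" and \<theta>: "\<theta> \<ge> 0"
  shows "graph_prob {G. (\<Sum>j\<in>T. adj_matrix G v j) < (\<Sum>j\<in>S. adj_matrix G v j) + g}
    \<le> exp ((exp \<theta> - 1) * (\<Sum>j\<in>S. P v j) + (exp (- \<theta>) - 1) * (\<Sum>j\<in>T. P v j) + \<theta> * g)"
proof -
  define s where "s j = (if j \<in> S then \<theta> else if j \<in> T then - \<theta> else 0)" for j
  have two_values: "(\<Sum>j<n. f j * (if j \<in> S then y else if j \<in> T then z else 0))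
      = y * (\<Sum>j\<in>S. f j) + z * (\<Sum>j\<in>T. f j)"
    for f :: "nat \<Rightarrow> real" and y z
  proof -
    have "(\<Sum>j<n. f j * (if j \<in> S then y else if j \<in> T then z else 0))
        = (\<Sum>j<n. if j \<in> S then y * f j else 0) + (\<Sum>j<n. if j \<in> T then z * f j else 0)"
      unfolding sum.distrib[symmetric] using disjoint by (intro sum.cong) auto
    also have "\<dots> = (\<Sum>j\<in>S. y * f j) + (\<Sum>j\<in>T. z * f j)"
      using S T by (simp flip: sum.inter_restrict add: Int_absorb1)
    finally show ?thesis by (simp add: sum_distrib_left)
  qed
  have sA: "(\<Sum>j<n. s j * adj_matrix G v j) = \<theta> * (\<Sum>j\<in>S. adj_matrix G v j) - \<theta> * (\<Sum>j\<in>T. adj_matrix G v j)" for G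
    using two_values[of "adj_matrix G v" \<theta> "- \<theta>"] by (simp add: s_def mult.commute)
  have "(\<Sum>j<n. P v j * (exp (s j) - 1))
      = (\<Sum>j<n. P v j * (if j \<in> S then exp \<theta> - 1 else if j \<in> T then exp (- \<theta>) - 1 else 0))"
    by (intro sum.cong) (auto simp: s_def)
  then have cumulant: "(\<Sum>j<n. P v j * (exp (s j) - 1))
      = (exp \<theta> - 1) * (\<Sum>j\<in>S. P v j) + (exp (- \<theta>) - 1) * (\<Sum>j\<in>T. P v j)"
    unfolding two_values .
  have "graph_prob {G. (\<Sum>j\<in>T. adj_matrix G v j) < (\<Sum>j\<in>S. adj_matrix G v j) + g}
      \<le> graph_prob {G. - (\<theta> * g) \<le> (\<Sum>j<n. s j * adj_matrix G v j)}"
  proof (rule measure_pmf.finite_measure_mono, clarify)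
    fix G assume "(\<Sum>j\<in>T. adj_matrix G v j) < (\<Sum>j\<in>S. adj_matrix G v j) + g"
    then have "\<theta> * (\<Sum>j\<in>T. adj_matrix G v j) \<le> \<theta> * ((\<Sum>j\<in>S. adj_matrix G v j) + g)"
      using \<theta> by (intro mult_left_mono) auto
    then show "- (\<theta> * g) \<le> (\<Sum>j<n. s j * adj_matrix G v j)"
      unfolding sA by (simp add: algebra_simps)
  qed simp
  also note weighted_degree_tail[OF v]
  finally show ?thesis by (simp add: cumulant)
qed

end

lemma exp_minus_linear_le:
  fixes x :: real
  shows "exp x - 1 - x \<le> x\<^sup>2 / 2 * exp \<bar>x\<bar>"
proof -
  obtain t where t: "\<bar>t\<bar> \<le> \<bar>x\<bar>" "exp x = (\<Sum>m<2. x ^ m / fact m) + exp t / fact 2 * x ^ 2"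
    using Maclaurin_exp_le[of x 2] by blast
  have "exp t \<le> exp \<bar>x\<bar>" using t(1) by simp
  then have "exp t * x\<^sup>2 \<le> exp \<bar>x\<bar> * x\<^sup>2" by (intro mult_right_mono) auto
  then show ?thesis using t(2) by (simp add: numeral_2_eq_2 mult_ac)
qed

lemma exp_scaled_le:
  fixes z \<theta> \<kappa> :: real
  assumes z: "\<bar>z\<bar> = 1" and \<theta>: "\<theta> \<ge> 0" and \<kappa>: "0 \<le> \<kappa>" "\<kappa> \<le> 2"
  shows "exp (z * \<theta> * \<kappa>) - 1 \<le> z * \<theta> * \<kappa> + \<theta>\<^sup>2 * exp (2 * \<theta>) * \<kappa>"
proof -
  have abs: "\<bar>z * \<theta> * \<kappa>\<bar> = \<theta> * \<kappa>" using z \<theta> \<kappa> by (simp add: abs_mult)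
  have "exp (z * \<theta> * \<kappa>) - 1 - z * \<theta> * \<kappa> \<le> (\<theta> * \<kappa>)\<^sup>2 / 2 * exp (\<theta> * \<kappa>)"
    using exp_minus_linear_le[of "z * \<theta> * \<kappa>"] by (metis abs power2_abs)
  also have "\<dots> \<le> \<theta>\<^sup>2 * \<kappa> * exp (2 * \<theta>)"
  proof (intro mult_mono)
    have "\<theta>\<^sup>2 * (\<kappa> * \<kappa>) \<le> \<theta>\<^sup>2 * (2 * \<kappa>)" using \<kappa> by (intro mult_left_mono mult_right_mono) auto
    then show "(\<theta> * \<kappa>)\<^sup>2 / 2 \<le> \<theta>\<^sup>2 * \<kappa>" by (simp add: power2_eq_square mult_ac)
    show "exp (\<theta> * \<kappa>) \<le> exp (2 * \<theta>)" using \<kappa> \<theta> mult_left_mono[of \<kappa> 2 \<theta>] by simp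
  qed (use \<kappa> in auto)
  finally show ?thesis by (simp add: mult_ac)
qed

lemma block_sum_eq_sum_indicator:
  fixes f :: "nat \<Rightarrow> nat \<Rightarrow> real"
  assumes "S \<subseteq> {..<n}" "T \<subseteq> {..<n}"
  shows "(\<Sum>i<n. \<Sum>j<n. f i j * of_bool (i \<in> S \<and> j \<in> T)) = block_sum f S T"
proof -
  have "(\<Sum>i<n. \<Sum>j<n. f i j * of_bool (i \<in> S \<and> j \<in> T)) = (\<Sum>i\<in>S. \<Sum>j<n. f i j * of_bool (i \<in> S \<and> j \<in> T))"
    using assms(1) by (intro sum.mono_neutral_right) auto
  also have "\<dots> = block_sum f S T"
    unfolding block_sum_def using assms(2) by (intro sum.cong refl sum.mono_neutral_cong_right) auto
  finally show ?thesis .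
qed

context edge_probabilities
begin

lemma block_cumulant_le:
  assumes S: "S \<subseteq> {..<n}" and T: "T \<subseteq> {..<n}" and z: "\<bar>z\<bar> = 1" and \<theta>: "\<theta> \<ge> 0"
    and w: "\<And>i j. w i j = z * \<theta> * of_bool (i \<in> S \<and> j \<in> T)"
  shows "(\<Sum>(i, j)\<in>vpairs n. P i j * (exp (w i j + w j i) - 1))
    \<le> z * \<theta> * block_sum P S T + \<theta>\<^sup>2 * exp (2 * \<theta>) * p * (card S * card T)"
proof -
  define k :: "nat \<Rightarrow> nat \<Rightarrow> real" where "k i j = of_bool (i \<in> S \<and> j \<in> T)" for i j
  define C where "C = z * \<theta> + \<theta>\<^sup>2 * exp (2 * \<theta>)"
  have "(\<Sum>(i, j)\<in>vpairs n. P i j * (exp (w i j + w j i) - 1))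
      \<le> (\<Sum>(i, j)\<in>vpairs n. C * (P i j * (k i j + k j i)))"
  proof (intro sum_mono, clarify)
    fix i j
    have "exp (z * \<theta> * (k i j + k j i)) - 1 \<le> C * (k i j + k j i)"
      using exp_scaled_le[OF z \<theta>, of "k i j + k j i"] by (simp add: k_def C_def distrib_right)
    then have "P i j * (exp (w i j + w j i) - 1) \<le> P i j * (C * (k i j + k j i))"
      using P_nonneg by (intro mult_left_mono) (auto simp: w k_def distrib_left)
    then show "P i j * (exp (w i j + w j i) - 1) \<le> C * (P i j * (k i j + k j i))"
      by (simp add: mult_ac)
  qed
  also have "\<dots> = C * (\<Sum>(i, j)\<in>vpairs n. P i j * (k i j + k j i))"
    by (simp add: case_prod_unfold sum_distrib_left)
  also have "\<dots> = z * \<theta> * block_sum P S T + \<theta>\<^sup>2 * exp (2 * \<theta>) * block_sum P S T"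
    using block_sum_eq_sum_indicator[OF S T, of P] by (simp add: sum_vpairs_weighted k_def C_def distrib_right)
  also have "\<dots> \<le> z * \<theta> * block_sum P S T + \<theta>\<^sup>2 * exp (2 * \<theta>) * (\<Sum>i\<in>S. \<Sum>j\<in>T. p)"
    unfolding block_sum_def by (intro add_left_mono mult_left_mono sum_mono P_le) auto
  finally show ?thesis by (simp add: mult_ac)
qed

lemma block_sum_tail:
  assumes S: "S \<subseteq> {..<n}" and T: "T \<subseteq> {..<n}" and z: "\<bar>z\<bar> = 1" and \<theta>: "\<theta> \<ge> 0"
  shows "graph_prob {G. u \<le> z * block_sum (centred_adj G) S T}
    \<le> exp (\<theta>\<^sup>2 * exp (2 * \<theta>) * p * (card S * card T) - \<theta> * u)"
proof -
  define w where "w i j = z * \<theta> * of_bool (i \<in> S \<and> j \<in> T)" for i j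
  have wA: "(\<Sum>i<n. \<Sum>j<n. w i j * adj_matrix G i j) = \<theta> * (z * block_sum (adj_matrix G) S T)" for G
    unfolding block_sum_eq_sum_indicator[OF S T, symmetric] w_def by (simp only: sum_distrib_left mult_ac)
  have "graph_prob {G. u \<le> z * block_sum (centred_adj G) S T}
      \<le> graph_prob {G. \<theta> * u + z * \<theta> * block_sum P S T \<le> (\<Sum>i<n. \<Sum>j<n. w i j * adj_matrix G i j)}"
  proof (rule measure_pmf.finite_measure_mono, clarify)
    fix G assume "u \<le> z * block_sum (centred_adj G) S T"
    then have "\<theta> * u \<le> \<theta> * (z * block_sum (centred_adj G) S T)" using \<theta> by (intro mult_left_mono)
    then show "\<theta> * u + z * \<theta> * block_sum P S T \<le> (\<Sum>i<n. \<Sum>j<n. w i j * adj_matrix G i j)"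
      unfolding wA block_sum_diff by (simp add: algebra_simps)
  qed simp
  also have "\<dots> \<le> exp ((\<Sum>(i, j)\<in>vpairs n. P i j * (exp (w i j + w j i) - 1))
      - (\<theta> * u + z * \<theta> * block_sum P S T))"
    by (rule weighted_edges_tail)
  also have "\<dots> \<le> exp (\<theta>\<^sup>2 * exp (2 * \<theta>) * p * (card S * card T) - \<theta> * u)"
    using block_cumulant_le[OF S T z \<theta> w_def] by simp
  finally show ?thesis .
qed

lemma abs_block_sum_tail:
  fixes x u :: real
  assumes S: "S \<subseteq> {..<n}" and T: "T \<subseteq> {..<n}" and \<theta>: "\<theta> \<ge> 0"
    and x: "x = sqrt (real (card S) * real (card T))"
    and small: "\<theta> * exp (2 * \<theta>) * p * x \<le> u / 2"
  shows "graph_prob {G. \<bar>block_sum (centred_adj G) S T\<bar> > u * x} \<le> 2 * exp (- (\<theta> * u * x / 2))"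
proof -
  have "\<theta>\<^sup>2 * exp (2 * \<theta>) * p * (card S * card T) = \<theta> * x * (\<theta> * exp (2 * \<theta>) * p * x)"
    by (simp add: x power2_eq_square mult_ac)
  also have "\<dots> \<le> \<theta> * x * (u / 2)"
    using small \<theta> by (intro mult_left_mono) (auto simp: x)
  finally have exponent: "\<theta>\<^sup>2 * exp (2 * \<theta>) * p * (card S * card T) - \<theta> * (u * x) \<le> - (\<theta> * u * x / 2)"
    by (simp add: mult_ac)
  have one_sided: "graph_prob {G. u * x \<le> z * block_sum (centred_adj G) S T} \<le> exp (- (\<theta> * u * x / 2))"
    if "\<bar>z\<bar> = 1" for z
    using block_sum_tail[OF S T that \<theta>, of "u * x"] exponent by (meson exp_le_cancel_iff order.trans)
  have "graph_prob {G. \<bar>block_sum (centred_adj G) S T\<bar> > u * x}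
      \<le> graph_prob ({G. u * x \<le> 1 * block_sum (centred_adj G) S T}
          \<union> {G. u * x \<le> (- 1) * block_sum (centred_adj G) S T})"
    by (intro measure_pmf.finite_measure_mono) auto
  also have "\<dots> \<le> graph_prob {G. u * x \<le> 1 * block_sum (centred_adj G) S T}
      + graph_prob {G. u * x \<le> (- 1) * block_sum (centred_adj G) S T}"
    by (intro measure_Un_le) auto
  finally show ?thesis using one_sided[of 1] one_sided[of "- 1"] by simp
qed

end

section \<open>Regularity at logarithmic degrees\<close>

lemma sum_Pow_power_card:
  fixes x :: "'a :: comm_semiring_1"
  assumes "finite A"
  shows "(\<Sum>S\<in>Pow A. x ^ card S) = (1 + x) ^ card A"
  using prod_add[OF assms, of "\<lambda>_. x" "\<lambda>_. 1"] by (simp add: add.commute)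

lemma sum_subset_pairs_le:
  assumes n: "n \<ge> 1"
  shows "(\<Sum>(S, T)\<in>Pow {..<n} \<times> Pow {..<n}.
      2 * (1 / real n) ^ (1 + card S + card T) + 2 * exp (- 3 * real n)) \<le> 20 / n"
proof -
  have "(1 + 1 / real n) ^ n \<le> exp (1 / real n) ^ n"
    by (intro power_mono exp_ge_add_one_self) auto
  also have "\<dots> = exp 1" using n by (simp add: exp_of_nat_mult[symmetric])
  finally have growth: "(1 + 1 / real n) ^ n \<le> 3" using exp_le by linarith
  have "(2 :: real) ^ n \<le> exp 1 ^ n"
    using exp_ge_add_one_self[of 1] by (intro power_mono) auto
  then have "2 ^ n * 2 ^ n * exp (- 3 * real n) \<le> exp n * exp n * exp (- 3 * real n)"
    by (intro mult_right_mono mult_mono) (auto simp: exp_of_nat_mult[symmetric])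
  also have "\<dots> = 1 / exp (real n)" by (simp add: exp_add[symmetric] exp_minus[symmetric] divide_inverse)
  also have "\<dots> \<le> 1 / n" using exp_gt_self[of "real n"] n by (intro divide_left_mono) auto
  finally have tiny: "2 ^ n * 2 ^ n * exp (- 3 * real n) \<le> 1 / n" .
  have "(\<Sum>(S, T)\<in>Pow {..<n} \<times> Pow {..<n}. 2 * (1 / real n) ^ (1 + card S + card T) + 2 * exp (- 3 * real n))
      = 2 / n * ((\<Sum>S\<in>Pow {..<n}. (1 / real n) ^ card S) * (\<Sum>T\<in>Pow {..<n}. (1 / real n) ^ card T))
        + 2 * (2 ^ n * 2 ^ n * exp (- 3 * real n))"
    by (simp add: sum_product sum.cartesian_product case_prod_unfold sum.distrib sum_distrib_left
        power_add card_cartesian_product card_Pow mult_ac)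
  also have "\<dots> = 2 / n * ((1 + 1 / real n) ^ n * (1 + 1 / real n) ^ n)
      + 2 * (2 ^ n * 2 ^ n * exp (- 3 * real n))"
    by (simp add: sum_Pow_power_card)
  also have "\<dots> \<le> 2 / n * (3 * 3) + 2 * (1 / n)"
    using growth tiny by (intro add_mono mult_left_mono mult_mono) auto
  finally show ?thesis by simp
qed

lemma sqrt_mult_card_bounds:
  assumes "comparable_cards \<epsilon> S T"
  shows "\<epsilon> * card T \<le> sqrt (real (card S) * real (card T))"
    and "sqrt (real (card S) * real (card T)) \<le> card T"
proof -
  have le: "real (card S) \<le> card T" "\<epsilon>\<^sup>2 * card T \<le> card S" using assms by (auto simp: comparable_cards_def)
  have "(\<epsilon> * card T)\<^sup>2 \<le> real (card S) * real (card T)"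
    using le(2) mult_right_mono[of "\<epsilon>\<^sup>2 * card T" "card S" "card T"] by (simp add: power2_eq_square mult_ac)
  then show "\<epsilon> * card T \<le> sqrt (real (card S) * real (card T))" by (rule real_le_rsqrt)
  show "sqrt (real (card S) * real (card T)) \<le> card T"
    using le(1) by (intro real_le_lsqrt) (auto simp: power2_eq_square intro: mult_right_mono)
qed

locale log_degree_graph = edge_probabilities n P "a * ln n / n" for n P a +
  assumes n_pos: "n \<ge> 1"
begin

lemma ln_nonneg: "0 \<le> ln (real n)"
  using n_pos by simp

lemma max_degree_tail:
  "graph_prob {G. \<exists>v<n. (2 * a + 2) * ln n < (\<Sum>j<n. adj_matrix G v j)} \<le> 1 / n"
proof -
  define heavy where "heavy v = {G. (2 * a + 2) * ln n \<le> (\<Sum>j<n. adj_matrix G v j)}" for v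
  have "graph_prob {G. \<exists>v<n. (2 * a + 2) * ln n < (\<Sum>j<n. adj_matrix G v j)}
      \<le> graph_prob (\<Union>v\<in>{..<n}. heavy v)"
    by (intro measure_pmf.finite_measure_mono) (auto simp: heavy_def)
  also have "\<dots> \<le> (\<Sum>v<n. graph_prob (heavy v))"
    by (intro measure_UNION_le) auto
  also have "\<dots> \<le> (\<Sum>v<n. exp (2 * (n * (a * ln n / n)) - (2 * a + 2) * ln n))"
    unfolding heavy_def by (intro sum_mono degree_tail) auto
  also have "2 * (n * (a * ln n / n)) - (2 * a + 2) * ln n = - ln n + - ln n"
    using n_pos by (simp add: algebra_simps)
  also have "exp (- ln (real n) + - ln n) = 1 / n * (1 / n)"
    unfolding exp_add using n_pos by (simp add: exp_minus field_simps)
  finally show ?thesis using n_pos by simp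
qed

lemma centred_row_sum_le:
  assumes "(\<Sum>j<n. adj_matrix G i j) \<le> C * ln n"
  shows "(\<Sum>j<n. \<bar>centred_adj G i j\<bar>) \<le> (C + a) * ln n"
proof -
  have "\<bar>centred_adj G i j\<bar> \<le> adj_matrix G i j + a * ln n / n" for j
    using P_le[of i j] P_nonneg[of i j] by (auto simp: adj_matrix_def)
  then have "(\<Sum>j<n. \<bar>centred_adj G i j\<bar>) \<le> (\<Sum>j<n. adj_matrix G i j + a * ln n / n)"
    by (intro sum_mono)
  also have "\<dots> \<le> C * ln n + a * ln n" using assms n_pos by (simp add: sum.distrib)
  finally show ?thesis by (simp add: distrib_right)
qed

lemma block_sum_log_tail:
  fixes x \<alpha> \<kappa> :: real
  assumes S: "S \<subseteq> {..<n}" and T: "T \<subseteq> {..<n}" and \<theta>: "\<theta> \<ge> 0" and a: "a \<ge> 0"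
    and x: "x = sqrt (real (card S) * real (card T))" "x \<le> \<kappa> * n"
    and small: "\<theta> * exp (2 * \<theta>) * a * \<kappa> \<le> \<alpha> / 2"
  shows "graph_prob {G. \<bar>block_sum (centred_adj G) S T\<bar> > \<alpha> * ln n * x} \<le> 2 * exp (- (\<theta> * \<alpha> * ln n * x / 2))"
proof -
  have "\<theta> * exp (2 * \<theta>) * (a * ln n / n) * x = \<theta> * exp (2 * \<theta>) * a * ln n * (x / n)" by simp
  also have "\<dots> \<le> \<theta> * exp (2 * \<theta>) * a * ln n * \<kappa>"
    using x(2) n_pos \<theta> a ln_nonneg by (intro mult_left_mono) (auto simp: field_simps)
  also have "\<dots> = (\<theta> * exp (2 * \<theta>) * a * \<kappa>) * ln n" by simp
  also have "\<dots> \<le> \<alpha> / 2 * ln n" using small ln_nonneg by (intro mult_right_mono)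
  finally have "\<theta> * exp (2 * \<theta>) * (a * ln n / n) * x \<le> \<alpha> * ln n / 2" by simp
  from abs_block_sum_tail[OF S T \<theta> x(1) this] show ?thesis by (simp add: mult.assoc)
qed

lemma small_comparable_block_tail:
  fixes \<kappa> :: real
  assumes S: "S \<subseteq> {..<n}" and T: "T \<subseteq> {..<n}" "T \<noteq> {}" and comparable: "comparable_cards \<epsilon> S T"
    and pos: "a \<ge> 0" "\<alpha> > 0" "\<epsilon> > 0" and \<theta>: "\<theta> = 6 / (\<alpha> * \<epsilon>)"
    and \<kappa>: "card T \<le> \<kappa> * n" "\<theta> * exp (2 * \<theta>) * a * \<kappa> \<le> \<alpha> / 2"
  shows "graph_prob {G. \<bar>block_sum (centred_adj G) S T\<bar> > \<alpha> * ln n * sqrt (real (card S) * real (card T))}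
    \<le> 2 * (1 / n) ^ (1 + card S + card T)"
proof -
  define x where "x = sqrt (real (card S) * real (card T))"
  note x = sqrt_mult_card_bounds[OF comparable, folded x_def]
  have T_pos: "card T \<ge> 1" using T finite_subset[of T "{..<n}"] by (simp add: Suc_leI card_gt_0_iff)
  have "graph_prob {G. \<bar>block_sum (centred_adj G) S T\<bar> > \<alpha> * ln n * x} \<le> 2 * exp (- (\<theta> * \<alpha> * ln n * x / 2))"
    using x(2) \<kappa> pos by (intro block_sum_log_tail[OF S T(1) _ _ x_def, where \<kappa> = \<kappa>]) (auto simp: \<theta>)
  also have "- (\<theta> * \<alpha> * ln n * x / 2) \<le> real (1 + card S + card T) * (- ln n)"
  proof -
    have "real (1 + card S + card T) * ln n \<le> real (3 * card T) * ln n"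
      using comparable T_pos ln_nonneg by (intro mult_right_mono) (auto simp: comparable_cards_def)
    also have "\<dots> = \<theta> * \<alpha> * ln n * (\<epsilon> * card T) / 2" using pos by (simp add: \<theta>)
    also have "\<dots> \<le> \<theta> * \<alpha> * ln n * x / 2"
      using x(1) pos ln_nonneg by (intro divide_right_mono mult_left_mono) (auto simp: \<theta>)
    finally show ?thesis by simp
  qed
  also have "exp (real (1 + card S + card T) * (- ln n)) = (1 / n) ^ (1 + card S + card T)"
    unfolding exp_of_nat_mult using n_pos by (simp add: exp_minus inverse_eq_divide)
  finally show ?thesis by (simp add: x_def)
qed

lemma large_comparable_block_tail:
  fixes \<kappa> :: real
  assumes S: "S \<subseteq> {..<n}" and T: "T \<subseteq> {..<n}" and comparable: "comparable_cards \<epsilon> S T"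
    and pos: "a \<ge> 0" "\<alpha> \<ge> 0" "\<epsilon> \<ge> 0" and \<theta>: "\<theta> \<ge> 0" "\<theta> * exp (2 * \<theta>) * a \<le> \<alpha> / 2"
    and \<kappa>: "\<kappa> * n \<le> card T" "6 \<le> \<theta> * \<alpha> * ln n * (\<epsilon> * \<kappa>)"
  shows "graph_prob {G. \<bar>block_sum (centred_adj G) S T\<bar> > \<alpha> * ln n * sqrt (real (card S) * real (card T))}
    \<le> 2 * exp (- 3 * real n)"
proof -
  define x where "x = sqrt (real (card S) * real (card T))"
  note x = sqrt_mult_card_bounds[OF comparable, folded x_def]
  have "real (card T) \<le> n" using card_mono[OF finite_lessThan T] by simp
  then have "graph_prob {G. \<bar>block_sum (centred_adj G) S T\<bar> > \<alpha> * ln n * x}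
      \<le> 2 * exp (- (\<theta> * \<alpha> * ln n * x / 2))"
    using x(2) \<theta> pos by (intro block_sum_log_tail[OF S T _ _ x_def, where \<kappa> = 1]) auto
  also have "- (\<theta> * \<alpha> * ln n * x / 2) \<le> - 3 * real n"
  proof -
    have "6 * real n \<le> \<theta> * \<alpha> * ln n * (\<epsilon> * \<kappa>) * n" using \<kappa>(2) by (intro mult_right_mono) auto
    also have "\<dots> = \<theta> * \<alpha> * ln n * (\<epsilon> * (\<kappa> * n))" by simp
    also have "\<dots> \<le> \<theta> * \<alpha> * ln n * (\<epsilon> * card T)"
      using \<kappa>(1) pos \<theta> ln_nonneg by (intro mult_left_mono) auto
    also have "\<dots> \<le> \<theta> * \<alpha> * ln n * x"
      using x(1) pos \<theta> ln_nonneg by (intro mult_left_mono) auto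
    finally show ?thesis by simp
  qed
  finally show ?thesis by (simp add: x_def)
qed

lemma comparable_discrepancy_union_bound:
  assumes tail: "\<And>S T. S \<subseteq> {..<n} \<Longrightarrow> T \<subseteq> {..<n} \<Longrightarrow> T \<noteq> {} \<Longrightarrow> comparable_cards \<epsilon> S T \<Longrightarrow>
    graph_prob {G. \<bar>block_sum (centred_adj G) S T\<bar> > \<beta> * sqrt (real (card S) * real (card T))}
      \<le> 2 * (1 / n) ^ (1 + card S + card T) + 2 * exp (- 3 * real n)"
  shows "graph_prob {G. \<not> comparable_discrepancy_le {..<n} \<epsilon> (centred_adj G) \<beta>} \<le> 20 / n"
proof -
  define pairs where "pairs = {(S, T) \<in> Pow {..<n} \<times> Pow {..<n}. T \<noteq> {} \<and> comparable_cards \<epsilon> S T}"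
  define bad where "bad = (\<lambda>(S, T).
    {G. \<bar>block_sum (centred_adj G) S T\<bar> > \<beta> * sqrt (real (card S) * real (card T))})"
  define bound where "bound = (\<lambda>(S :: nat set, T :: nat set).
    2 * (1 / real n) ^ (1 + card S + card T) + 2 * exp (- 3 * real n))"
  have pairs: "pairs \<subseteq> Pow {..<n} \<times> Pow {..<n}" by (auto simp: pairs_def)
  then have finite_pairs: "finite pairs" by (rule finite_subset) auto
  have "{G. \<not> comparable_discrepancy_le {..<n} \<epsilon> (centred_adj G) \<beta>} \<subseteq> (\<Union>ST\<in>pairs. bad ST)"
  proof
    fix G assume "G \<in> {G. \<not> comparable_discrepancy_le {..<n} \<epsilon> (centred_adj G) \<beta>}"
    then obtain S T where ST: "S \<subseteq> {..<n}" "T \<subseteq> {..<n}" "comparable_cards \<epsilon> S T"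
      and large: "\<beta> * sqrt (real (card S) * real (card T)) < \<bar>block_sum (centred_adj G) S T\<bar>"
      unfolding comparable_discrepancy_le_def by (auto simp: not_le)
    from large have "T \<noteq> {}" by (auto simp: block_sum_def)
    with ST large show "G \<in> (\<Union>ST\<in>pairs. bad ST)" by (intro UN_I[of "(S, T)"]) (auto simp: pairs_def bad_def)
  qed
  then have "graph_prob {G. \<not> comparable_discrepancy_le {..<n} \<epsilon> (centred_adj G) \<beta>}
      \<le> graph_prob (\<Union>ST\<in>pairs. bad ST)"
    by (intro measure_pmf.finite_measure_mono) auto
  also have "\<dots> \<le> (\<Sum>ST\<in>pairs. graph_prob (bad ST))"
    by (intro measure_UNION_le finite_pairs) auto
  also have "\<dots> \<le> (\<Sum>ST\<in>pairs. bound ST)"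
    using tail by (intro sum_mono) (auto simp: pairs_def bad_def bound_def)
  also have "\<dots> \<le> (\<Sum>ST\<in>Pow {..<n} \<times> Pow {..<n}. bound ST)"
    by (intro sum_mono2 pairs) (auto simp: bound_def)
  also have "\<dots> \<le> 20 / n" unfolding bound_def by (rule sum_subset_pairs_le[OF n_pos])
  finally show ?thesis .
qed

text \<open>For pairs of small sets a large exponential tilt beats the entropy \<open>n\<close> to the power \<open>|S| + |T|\<close>;
  for pairs of linear size any fixed tilt gives \<open>exp (- c n log n)\<close>, which beats the \<open>4 ^ n\<close> pairs.\<close>

lemma not_comparable_discrepancy_prob_le:
  fixes \<kappa> :: real
  assumes pos: "a \<ge> 0" "\<alpha> > 0" "\<epsilon> > 0"
    and \<theta>\<^sub>1: "\<theta>\<^sub>1 = 6 / (\<alpha> * \<epsilon>)" "\<theta>\<^sub>1 * exp (2 * \<theta>\<^sub>1) * a * \<kappa> \<le> \<alpha> / 2"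
    and \<theta>\<^sub>2: "\<theta>\<^sub>2 \<ge> 0" "\<theta>\<^sub>2 * exp (2 * \<theta>\<^sub>2) * a \<le> \<alpha> / 2"
    and large: "6 \<le> \<theta>\<^sub>2 * \<alpha> * ln n * (\<epsilon> * \<kappa>)"
  shows "graph_prob {G. \<not> comparable_discrepancy_le {..<n} \<epsilon> (centred_adj G) (\<alpha> * ln n)} \<le> 20 / n"
proof (rule comparable_discrepancy_union_bound)
  fix S T assume S: "S \<subseteq> {..<n}" and T: "T \<subseteq> {..<n}" "T \<noteq> {}" and comparable: "comparable_cards \<epsilon> S T"
  let ?tail = "graph_prob {G. \<alpha> * ln n * sqrt (real (card S) * real (card T)) < \<bar>block_sum (centred_adj G) S T\<bar>}"
  show "?tail \<le> 2 * (1 / n) ^ (1 + card S + card T) + 2 * exp (- 3 * real n)"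
  proof (cases "card T \<le> \<kappa> * n")
    case True
    have "?tail \<le> 2 * (1 / n) ^ (1 + card S + card T)"
      by (rule small_comparable_block_tail[OF S T comparable pos \<theta>\<^sub>1(1) True \<theta>\<^sub>1(2)])
    also have "\<dots> \<le> 2 * (1 / n) ^ (1 + card S + card T) + 2 * exp (- 3 * real n)" by simp
    finally show ?thesis .
  next
    case False
    then have "?tail \<le> 2 * exp (- 3 * real n)"
      using pos \<theta>\<^sub>2 large by (intro large_comparable_block_tail[OF S T(1) comparable]) auto
    also have "\<dots> \<le> 2 * (1 / n) ^ (1 + card S + card T) + 2 * exp (- 3 * real n)" by simp
    finally show ?thesis .
  qed
qed

end

lemma eventually_comparable_discrepancy:
  fixes a \<alpha> \<epsilon> :: real
  assumes a: "a > 0" and \<alpha>: "\<alpha> > 0" and \<epsilon>: "\<epsilon> > 0"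
  shows "\<forall>\<^sub>F n in sequentially. \<forall>P. log_degree_graph n P a \<longrightarrow> measure_pmf.prob (random_graph n P)
    {G. \<not> comparable_discrepancy_le {..<n} \<epsilon> (\<lambda>i j. adj_matrix G i j - P i j) (\<alpha> * ln n)} \<le> 20 / n"
proof -
  define \<theta>\<^sub>1 where "\<theta>\<^sub>1 = 6 / (\<alpha> * \<epsilon>)"
  define \<kappa> where "\<kappa> = \<alpha> / (2 * \<theta>\<^sub>1 * exp (2 * \<theta>\<^sub>1) * a)"
  define \<theta>\<^sub>2 where "\<theta>\<^sub>2 = min 1 (\<alpha> / (2 * exp 2 * a))"
  have \<kappa>: "\<kappa> > 0" "\<theta>\<^sub>1 * exp (2 * \<theta>\<^sub>1) * a * \<kappa> \<le> \<alpha> / 2"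
    using \<alpha> \<epsilon> a by (simp_all add: \<theta>\<^sub>1_def \<kappa>_def)
  have \<theta>\<^sub>2: "\<theta>\<^sub>2 > 0" "\<theta>\<^sub>2 \<le> 1" "\<theta>\<^sub>2 \<le> \<alpha> / (2 * exp 2 * a)" using \<alpha> a by (auto simp: \<theta>\<^sub>2_def)
  have "\<theta>\<^sub>2 * exp (2 * \<theta>\<^sub>2) * a \<le> \<alpha> / (2 * exp 2 * a) * exp 2 * a"
    using \<theta>\<^sub>2 a \<alpha> by (intro mult_mono) auto
  then have small\<^sub>2: "\<theta>\<^sub>2 * exp (2 * \<theta>\<^sub>2) * a \<le> \<alpha> / 2" using a by simp
  have "filterlim (\<lambda>n. ln (real n)) at_top sequentially" by real_asymp
  then have "\<forall>\<^sub>F n in sequentially. 6 / (\<theta>\<^sub>2 * \<alpha> * (\<epsilon> * \<kappa>)) \<le> ln (real n)"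
    unfolding filterlim_at_top by blast
  then show ?thesis
  proof (eventually_elim, intro allI impI)
    fix n P assume large: "6 / (\<theta>\<^sub>2 * \<alpha> * (\<epsilon> * \<kappa>)) \<le> ln (real n)" and "log_degree_graph n P a"
    interpret log_degree_graph n P a by fact
    have "6 \<le> \<theta>\<^sub>2 * \<alpha> * ln n * (\<epsilon> * \<kappa>)"
      using large \<theta>\<^sub>2(1) \<alpha> \<epsilon> \<kappa>(1) by (simp add: divide_le_eq mult_ac)
    then show "graph_prob {G. \<not> comparable_discrepancy_le {..<n} \<epsilon> (centred_adj G) (\<alpha> * ln n)} \<le> 20 / n"
      using a \<alpha> \<epsilon> \<theta>\<^sub>2(1)
      by (intro not_comparable_discrepancy_prob_le[OF _ _ _ \<theta>\<^sub>1_def \<kappa>(2) _ small\<^sub>2]) auto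
  qed
qed

section \<open>Exact recovery\<close>

abbreviation sbm_mean :: "nat \<Rightarrow> real \<Rightarrow> real \<Rightarrow> (nat \<Rightarrow> nat) \<Rightarrow> nat \<Rightarrow> nat \<Rightarrow> real" where
  "sbm_mean n a b \<equiv> mean_matrix (a * ln n / n) (b * ln n / n)"

lemma sbm_eq_random_graph: "sbm n a b \<sigma> = random_graph n (sbm_mean n a b \<sigma>)"
  unfolding sbm_def random_graph_def by (rule Pi_pmf_cong) (auto simp: mean_matrix_def vpairs_def)

lemma bernoulli_tilt_eq:
  fixes a b :: real
  assumes "a > 0" "b > 0" and \<theta>: "\<theta> = ln (a / b) / 2"
  shows "b * (exp \<theta> - 1) + a * (exp (- \<theta>) - 1) = - (sqrt a - sqrt b)\<^sup>2"
proof -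
  have "exp \<theta> = (a / b) powr (1 / 2)" unfolding \<theta> using assms(1,2) by (simp add: powr_def)
  then have exp_\<theta>: "exp \<theta> = sqrt a / sqrt b"
    using assms(1,2) by (simp add: powr_half_sqrt real_sqrt_divide)
  have "b * exp \<theta> = sqrt a * (b / sqrt b)" by (simp add: exp_\<theta>)
  then have "b * exp \<theta> = sqrt a * sqrt b" using assms(2) by (simp add: real_div_sqrt)
  moreover have "a * exp (- \<theta>) = (a / sqrt a) * sqrt b" by (simp add: exp_minus exp_\<theta>)
  then have "a * exp (- \<theta>) = sqrt a * sqrt b" using assms(1) by (simp add: real_div_sqrt)
  ultimately show ?thesis using assms(1,2) by (simp add: right_diff_distrib power2_diff)
qed

locale sbm_instance = balanced_clustering n r K \<sigma> for n r K \<sigma> +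
  fixes a b :: real
  assumes n_pos: "n \<ge> 1" and b_pos: "0 < b" and b_less_a: "b < a" and within_prob_le_1: "a * ln n / n \<le> 1"
begin

sublocale log_degree_graph n "sbm_mean n a b \<sigma>" a
proof
  have "0 \<le> b * ln n / n" "b * ln n / n \<le> a * ln n / n"
    using n_pos b_pos b_less_a by (auto intro!: divide_right_mono mult_right_mono)
  then show "0 \<le> sbm_mean n a b \<sigma> i j" "sbm_mean n a b \<sigma> i j \<le> a * ln n / n" for i j
    by (auto simp: mean_matrix_def)
qed (use n_pos within_prob_le_1 in \<open>auto simp: mean_matrix_def\<close>)

lemma sizes_pos: "r > 0" "K > 0"
  using n_pos n_eq by (auto intro: gr0I)

lemma sum_mean_foreign_cluster:
  assumes "l < r" "l \<noteq> \<sigma> v"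
  shows "(\<Sum>j\<in>cluster l. sbm_mean n a b \<sigma> v j) = b * ln n / r"
proof -
  have "(\<Sum>j\<in>cluster l. sbm_mean n a b \<sigma> v j) = (\<Sum>j\<in>cluster l. b * ln n / n)"
    using assms by (intro sum.cong) (auto simp: mean_matrix_def)
  also have "\<dots> = b * ln n / r" using card_cluster[OF assms(1)] sizes_pos by (simp add: n_eq)
  finally show ?thesis .
qed

lemma sum_mean_own_cluster_ge:
  assumes v: "v < n"
  shows "a * ln n / r - 1 \<le> (\<Sum>j\<in>cluster (\<sigma> v). sbm_mean n a b \<sigma> v j)"
proof -
  have "(\<Sum>j\<in>cluster (\<sigma> v). sbm_mean n a b \<sigma> v j)
      = (\<Sum>j\<in>cluster (\<sigma> v). a * ln n / n) - (\<Sum>j\<in>cluster (\<sigma> v). if j = v then a * ln n / n else 0)"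
    unfolding sum_subtractf[symmetric] by (intro sum.cong) (auto simp: mean_matrix_def)
  also have "\<dots> = K * (a * ln n / n) - a * ln n / n"
    using v card_cluster[OF label_less[OF v]] by simp
  also have "K * (a * ln n / n) = a * ln n / r"
    using sizes_pos by (simp add: n_eq)
  finally show ?thesis using within_prob_le_1 by simp
qed

lemma cluster_gap_tail:
  assumes v: "v < n" and l: "l < r" "l \<noteq> \<sigma> v" and \<theta>: "\<theta> = ln (a / b) / 2"
  shows "graph_prob {G. cluster_degree (adj_matrix G) v (\<sigma> v) < cluster_degree (adj_matrix G) v l + g}
    \<le> exp (1 + \<theta> * g - (sqrt a - sqrt b)\<^sup>2 / r * ln n)"
proof -
  define own where "own = (\<Sum>j\<in>cluster (\<sigma> v). sbm_mean n a b \<sigma> v j)"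
  have \<theta>_pos: "\<theta> > 0" using b_pos b_less_a by (simp add: \<theta>)
  have "(exp (- \<theta>) - 1) * own \<le> (exp (- \<theta>) - 1) * (a * ln n / r - 1)"
    unfolding own_def using \<theta>_pos sum_mean_own_cluster_ge[OF v] by (intro mult_left_mono_neg) auto
  also have "\<dots> \<le> (exp (- \<theta>) - 1) * (a * ln n / r) + 1" by (simp add: right_diff_distrib)
  finally have "(exp \<theta> - 1) * (b * ln n / r) + (exp (- \<theta>) - 1) * own
      \<le> (b * (exp \<theta> - 1) + a * (exp (- \<theta>) - 1)) * (ln n / r) + 1"
    by (simp add: algebra_simps add_divide_distrib diff_divide_distrib)
  also have "\<dots> = 1 - (sqrt a - sqrt b)\<^sup>2 / r * ln n"
    using bernoulli_tilt_eq[OF _ b_pos \<theta>] b_pos b_less_a by simp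
  finally have "exp ((exp \<theta> - 1) * (b * ln n / r) + (exp (- \<theta>) - 1) * own + \<theta> * g)
      \<le> exp (1 + \<theta> * g - (sqrt a - sqrt b)\<^sup>2 / r * ln n)" by simp
  moreover have "cluster l \<inter> cluster (\<sigma> v) = {}" using l by auto
  ultimately show ?thesis
    using degree_difference_tail[OF v cluster_subset cluster_subset _ less_imp_le[OF \<theta>_pos], of l "\<sigma> v" g]
    unfolding cluster_degree_def sum_mean_foreign_cluster[OF l] own_def by linarith
qed

lemma not_cluster_gap_prob_le:
  assumes \<theta>: "\<theta> = ln (a / b) / 2"
  shows "graph_prob {G. \<not> cluster_gap (adj_matrix G) (\<eta> * ln n)}
    \<le> 3 * real r * n powr (1 + \<theta> * \<eta> - (sqrt a - sqrt b)\<^sup>2 / r)"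
proof -
  define pairs where "pairs = {(v, l) \<in> {..<n} \<times> {..<r}. l \<noteq> \<sigma> v}"
  define gapless where "gapless = (\<lambda>(v, l). {G. cluster_degree (adj_matrix G) v (\<sigma> v)
      < cluster_degree (adj_matrix G) v l + \<eta> * ln n})"
  define \<epsilon> where "\<epsilon> = exp (1 + \<theta> * (\<eta> * ln n) - (sqrt a - sqrt b)\<^sup>2 / r * ln n)"
  have pairs: "pairs \<subseteq> {..<n} \<times> {..<r}" by (auto simp: pairs_def)
  then have finite_pairs: "finite pairs" by (rule finite_subset) simp
  have "graph_prob {G. \<not> cluster_gap (adj_matrix G) (\<eta> * ln n)} \<le> graph_prob (\<Union>x\<in>pairs. gapless x)"
    by (intro measure_pmf.finite_measure_mono) (auto simp: cluster_gap_def pairs_def gapless_def not_le)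
  also have "\<dots> \<le> (\<Sum>x\<in>pairs. graph_prob (gapless x))"
    by (intro measure_UNION_le finite_pairs) auto
  also have "\<dots> \<le> (\<Sum>x\<in>pairs. \<epsilon>)"
    using cluster_gap_tail[OF _ _ _ \<theta>, of _ _ "\<eta> * ln n"]
    by (intro sum_mono) (auto simp: pairs_def gapless_def \<epsilon>_def)
  also have "\<dots> \<le> (\<Sum>x\<in>{..<n} \<times> {..<r}. \<epsilon>)"
    by (intro sum_mono2 pairs) (auto simp: \<epsilon>_def)
  also have "\<dots> = r * (n * \<epsilon>)" by (simp add: card_cartesian_product)
  also have "n * \<epsilon> = exp (ln n) * \<epsilon>" using n_pos by simp
  also have "\<dots> = exp 1 * n powr (1 + \<theta> * \<eta> - (sqrt a - sqrt b)\<^sup>2 / r)"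
    unfolding \<epsilon>_def exp_add[symmetric] powr_def using n_pos by (simp add: exp_add[symmetric] algebra_simps)
  also have "r * \<dots> \<le> r * (3 * n powr (1 + \<theta> * \<eta> - (sqrt a - sqrt b)\<^sup>2 / r))"
    using exp_le by (intro mult_left_mono mult_right_mono) auto
  finally show ?thesis by (simp add: mult_ac)
qed

lemma regular_graph_imp_sdp_unique_opt:
  assumes r: "r \<ge> 2" and n: "n \<ge> 2" and \<alpha>: "\<alpha> > 0" and C: "C > 0"
    and degree: "\<And>v. v < n \<Longrightarrow> (\<Sum>j<n. adj_matrix G v j) \<le> C * ln n"
    and gap: "cluster_gap (adj_matrix G) (\<eta> * ln n)"
    and comparable: "comparable_discrepancy_le {..<n} (\<alpha> / (C + a)) (centred_adj G) (\<alpha> * ln n)"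
    and small: "16 * \<alpha> * (2 * real R + 1) + 2 * (C + a) / 2 ^ R + (real r + 1) * \<alpha> < \<eta>"
  shows "sdp_unique_opt n K (adj_matrix G) (cluster_matrix \<sigma>)"
proof -
  define \<gamma> where "\<gamma> = 16 * (\<alpha> * ln n) * (2 * real R + 1) + 2 * ((C + a) * ln n) / 2 ^ R"
  have ln_pos: "ln (real n) > 0" using n by simp
  have row: "(\<Sum>j<n. \<bar>centred_adj G i j\<bar>) \<le> (C + a) * ln n" if "i \<in> {..<n}" for i
    using degree that by (intro centred_row_sum_le) auto
  have disc: "discrepancy_le {..<n} (centred_adj G) (\<alpha> * ln n)"
  proof (rule comparable_imp_discrepancy_le[OF finite_lessThan centred_adj_sym row])
    show "0 < (C + a) * ln n" "0 \<le> \<alpha> * ln n" using C \<alpha> b_pos b_less_a ln_pos by auto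
    show "comparable_discrepancy_le {..<n} (\<alpha> * ln n / ((C + a) * ln n)) (centred_adj G) (\<alpha> * ln n)"
      using comparable ln_pos by simp
  qed
  interpret regular_clustering n r K \<sigma> "adj_matrix G" "a * ln n / n" "b * ln n / n" "\<alpha> * ln n" \<gamma> "\<eta> * ln n"
  proof
    show "quad_form {..<n} (centred_adj G) x \<le> \<gamma> * (\<Sum>i<n. (x i)\<^sup>2)" for x
      unfolding \<gamma>_def using \<alpha> ln_pos
      by (intro discrepancy_imp_quad_form_le finite_lessThan centred_adj_sym row disc) auto
    have "(16 * \<alpha> * (2 * real R + 1) + 2 * (C + a) / 2 ^ R + (real r + 1) * \<alpha>) * ln n < \<eta> * ln n"
      using small ln_pos by (rule mult_strict_right_mono)
    then show "\<gamma> + (r + 1) * (\<alpha> * ln n) < \<eta> * ln n" by (simp add: \<gamma>_def algebra_simps)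
    show "0 \<le> a * ln n / n" by (rule p_nonneg)
    show "0 \<le> \<alpha> * ln n" using \<alpha> ln_pos by simp
  qed (fact r sizes_pos adj_matrix_sym disc gap)+
  show ?thesis by (rule sdp_unique_opt)
qed

lemma recovery_failure_prob_le:
  assumes r: "r \<ge> 2" and n: "n \<ge> 2" and \<alpha>: "\<alpha> > 0" and \<theta>: "\<theta> = ln (a / b) / 2"
    and small: "16 * \<alpha> * (2 * real R + 1) + 2 * (3 * a + 2) / 2 ^ R + (real r + 1) * \<alpha> < \<eta>"
    and comparable: "graph_prob {G. \<not> comparable_discrepancy_le {..<n} (\<alpha> / (3 * a + 2))
      (centred_adj G) (\<alpha> * ln n)} \<le> 20 / n"
  shows "graph_prob {G. \<not> sdp_unique_opt n K (adj_matrix G) (cluster_matrix \<sigma>)}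
    \<le> 21 / n + 3 * real r * n powr (1 + \<theta> * \<eta> - (sqrt a - sqrt b)\<^sup>2 / r)"
proof -
  define heavy where "heavy = {G. \<exists>v<n. (2 * a + 2) * ln n < (\<Sum>j<n. adj_matrix G v j)}"
  define gapless where "gapless = {G. \<not> cluster_gap (adj_matrix G) (\<eta> * ln n)}"
  define discrepant where
    "discrepant = {G. \<not> comparable_discrepancy_le {..<n} (\<alpha> / (3 * a + 2)) (centred_adj G) (\<alpha> * ln n)}"
  have C: "2 * a + 2 > 0" "2 * a + 2 + a = 3 * a + 2" using b_pos b_less_a by auto
  have "sdp_unique_opt n K (adj_matrix G) (cluster_matrix \<sigma>)" if "G \<notin> heavy \<union> gapless \<union> discrepant" for G
  proof (rule regular_graph_imp_sdp_unique_opt[OF r n \<alpha> C(1), unfolded C(2), OF _ _ _ small])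
    show "(\<Sum>j<n. adj_matrix G v j) \<le> (2 * a + 2) * ln n" if "v < n" for v
      using \<open>G \<notin> _\<close> that by (auto simp: heavy_def)
  qed (use that in \<open>auto simp: gapless_def discrepant_def\<close>)
  then have "graph_prob {G. \<not> sdp_unique_opt n K (adj_matrix G) (cluster_matrix \<sigma>)}
      \<le> graph_prob (heavy \<union> gapless \<union> discrepant)"
    by (intro measure_pmf.finite_measure_mono) auto
  also have "\<dots> \<le> graph_prob heavy + graph_prob gapless + graph_prob discrepant"
    by (intro order.trans[OF measure_Un_le] add_right_mono measure_Un_le) auto
  also have "\<dots> \<le> 1 / n + 3 * real r * n powr (1 + \<theta> * \<eta> - (sqrt a - sqrt b)\<^sup>2 / r) + 20 / n"
    unfolding heavy_def gapless_def discrepant_def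
    by (intro add_mono max_degree_tail not_cluster_gap_prob_le \<theta> comparable)
  finally show ?thesis by simp
qed

end

lemma ex_small_discrepancy_constant:
  fixes \<eta> D s :: real
  assumes \<eta>: "\<eta> > 0" and s: "s \<ge> 0"
  obtains \<alpha> R where "\<alpha> > 0" "16 * \<alpha> * (2 * real R + 1) + 2 * D / 2 ^ R + s * \<alpha> < \<eta>"
proof -
  obtain R where "4 * D / \<eta> < 2 ^ R" using real_arch_pow[of 2 "4 * D / \<eta>"] by auto
  then have tail: "2 * D / 2 ^ R < \<eta> / 2" using \<eta> by (simp add: field_simps)
  define m where "m = 16 * (2 * real R + 1) + s"
  have m: "m > 0" using s by (simp add: m_def add_pos_nonneg)
  define \<alpha> where "\<alpha> = \<eta> / (2 * m)"
  have "16 * \<alpha> * (2 * real R + 1) + s * \<alpha> = \<alpha> * m" by (simp add: m_def algebra_simps)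
  also have "\<dots> = \<eta> / 2" using m by (simp add: \<alpha>_def)
  finally have "16 * \<alpha> * (2 * real R + 1) + 2 * D / 2 ^ R + s * \<alpha> < \<eta>" using tail by linarith
  moreover have "\<alpha> > 0" using \<eta> m by (simp add: \<alpha>_def)
  ultimately show thesis using that by blast
qed

lemma eventually_recovery_failure_le:
  fixes a b \<eta> :: real
  assumes r: "r \<ge> 2" and b: "0 < b" and ba: "b < a" and \<eta>: "\<eta> > 0" and \<theta>: "\<theta> = ln (a / b) / 2"
  shows "\<forall>\<^sub>F n in sequentially. \<forall>K \<sigma>. n = r * K \<and> balanced_labelling r K \<sigma> \<longrightarrow>
    measure_pmf.prob (sbm n a b \<sigma>) {G. \<not> sdp_unique_opt n K (adj_matrix G) (cluster_matrix \<sigma>)}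
      \<le> 21 / n + 3 * real r * n powr (1 + \<theta> * \<eta> - (sqrt a - sqrt b)\<^sup>2 / r)"
proof -
  obtain \<alpha> R where \<alpha>: "\<alpha> > 0"
    and small: "16 * \<alpha> * (2 * real R + 1) + 2 * (3 * a + 2) / 2 ^ R + (real r + 1) * \<alpha> < \<eta>"
    using ex_small_discrepancy_constant[OF \<eta>, of "real r + 1" "3 * a + 2"] by auto
  have "((\<lambda>n. a * ln (real n) / real n) \<longlongrightarrow> 0) sequentially" by real_asymp
  then have sparse: "\<forall>\<^sub>F n in sequentially. a * ln (real n) / real n < 1"
    by (rule order_tendstoD) simp
  have "\<alpha> / (3 * a + 2) > 0" using \<alpha> b ba by simp
  from eventually_comparable_discrepancy[OF less_trans[OF b ba] \<alpha> this] sparse eventually_ge_at_top[of 2]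
  show ?thesis
  proof (eventually_elim, intro allI impI, elim conjE)
    fix n K \<sigma>
    assume comparable: "\<forall>P. log_degree_graph n P a \<longrightarrow> measure_pmf.prob (random_graph n P)
      {G. \<not> comparable_discrepancy_le {..<n} (\<alpha> / (3 * a + 2))
        (\<lambda>i j. adj_matrix G i j - P i j) (\<alpha> * ln n)} \<le> 20 / n"
      and sparse: "a * ln (real n) / real n < 1" and n: "2 \<le> n" and "n = r * K" "balanced_labelling r K \<sigma>"
    interpret sbm_instance n r K \<sigma> a b
      by unfold_locales (fact | use sparse n in linarith)+
    show "measure_pmf.prob (sbm n a b \<sigma>) {G. \<not> sdp_unique_opt n K (adj_matrix G) (cluster_matrix \<sigma>)}
        \<le> 21 / n + 3 * real r * n powr (1 + \<theta> * \<eta> - (sqrt a - sqrt b)\<^sup>2 / r)"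
      unfolding sbm_eq_random_graph using comparable log_degree_graph_axioms
      by (intro recovery_failure_prob_le[OF r n \<alpha> \<theta> small]) blast
  qed
qed

lemma eventually_failure_bound_le_powr:
  fixes c \<delta> s :: real
  assumes "c < 1" "c < \<delta>"
  shows "\<forall>\<^sub>F n in sequentially. 21 / n + s * real n powr (- \<delta>) \<le> real n powr (- c)"
proof -
  have "(\<lambda>n. 21 / real n) \<in> o(\<lambda>n. real n powr (- c))" using assms(1) by real_asymp
  moreover have "(\<lambda>n. real n powr (- \<delta>)) \<in> o(\<lambda>n. real n powr (- c))" using assms(2) by real_asymp
  ultimately have "(\<lambda>n. 21 / n + s * real n powr (- \<delta>)) \<in> o(\<lambda>n. real n powr (- c))"
    by (cases "s = 0") (auto intro: sum_in_smallo)
  from landau_o.smallD[OF this, of 1] show ?thesis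
    by (auto elim!: eventually_mono)
qed

lemma eventually_recovery_failure_le_powr:
  fixes a b :: real
  assumes r: "r \<ge> 2" and b: "0 < b" and ba: "b < a" and separated: "sqrt a - sqrt b > sqrt (real r)"
  shows "\<exists>c > 0. \<forall>\<^sub>F n in sequentially. \<forall>K \<sigma>. n = r * K \<and> balanced_labelling r K \<sigma> \<longrightarrow>
    measure_pmf.prob (sbm n a b \<sigma>) {G. \<not> sdp_unique_opt n K (adj_matrix G) (cluster_matrix \<sigma>)}
      \<le> real n powr (- c)"
proof -
  define \<theta> where "\<theta> = ln (a / b) / 2"
  define \<delta> where "\<delta> = ((sqrt a - sqrt b)\<^sup>2 / r - 1) / 2"
  define c where "c = min 1 \<delta> / 2"
  have "(sqrt r)\<^sup>2 < (sqrt a - sqrt b)\<^sup>2" using separated by (intro power_strict_mono) auto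
  then have \<delta>: "\<delta> > 0" using r by (simp add: \<delta>_def)
  then have c: "c > 0" "c < 1" "c < \<delta>" by (auto simp: c_def)
  have \<theta>: "\<theta> > 0" using b ba by (simp add: \<theta>_def)
  then have exponent: "1 + \<theta> * (\<delta> / \<theta>) - (sqrt a - sqrt b)\<^sup>2 / r = - \<delta>" by (simp add: \<delta>_def field_simps)
  from eventually_recovery_failure_le[OF r b ba divide_pos_pos[OF \<delta> \<theta>] \<theta>_def, unfolded exponent]
    eventually_failure_bound_le_powr[OF c(2,3), of "3 * real r"]
  have "\<forall>\<^sub>F n in sequentially. \<forall>K \<sigma>. n = r * K \<and> balanced_labelling r K \<sigma> \<longrightarrow>
      measure_pmf.prob (sbm n a b \<sigma>) {G. \<not> sdp_unique_opt n K (adj_matrix G) (cluster_matrix \<sigma>)}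
        \<le> real n powr (- c)"
    by eventually_elim (intro allI impI, erule order.trans[rotated], blast)
  with c(1) show ?thesis by blast
qed

theorem theorem4:
  fixes r :: nat and a b :: real
  assumes "r \<ge> 2" and "0 < b" and "b < a"
    and "sqrt a - sqrt b > sqrt (real r)"
  shows "\<exists>c > 0. \<exists>K0. \<forall>K \<ge> K0. \<forall>\<sigma>. balanced_labelling r K \<sigma> \<longrightarrow>
           measure_pmf.prob (sbm (r * K) a b \<sigma>)
             {G. sdp_unique_opt (r * K) K (adj_matrix G) (cluster_matrix \<sigma>)}
           \<ge> 1 - real (r * K) powr (- c)"
proof -
  obtain c N where c: "c > 0" and failure: "\<And>K \<sigma>. r * K \<ge> N \<Longrightarrow> balanced_labelling r K \<sigma> \<Longrightarrow>
      measure_pmf.prob (sbm (r * K) a b \<sigma>) {G. \<not> sdp_unique_opt (r * K) K (adj_matrix G) (cluster_matrix \<sigma>)}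
        \<le> real (r * K) powr (- c)"
    using eventually_recovery_failure_le_powr[OF assms] unfolding eventually_sequentially by blast
  show ?thesis
  proof (intro exI conjI allI impI)
    show "c > 0" by (rule c)
    fix K \<sigma> assume "N \<le> K" and balanced: "balanced_labelling r K \<sigma>"
    then have "N \<le> r * K" using mult_le_mono[of 1 r N K] assms(1) by simp
    from failure[OF this balanced]
    show "1 - real (r * K) powr (- c) \<le> measure_pmf.prob (sbm (r * K) a b \<sigma>)
        {G. sdp_unique_opt (r * K) K (adj_matrix G) (cluster_matrix \<sigma>)}"
      using measure_pmf.prob_neg[of "sbm (r * K) a b \<sigma>"
        "\<lambda>G. sdp_unique_opt (r * K) K (adj_matrix G) (cluster_matrix \<sigma>)"]
      by simp
  qed
qed

end
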